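(* Let $m,n,r,s,\lambda$ be positive integers with $n>m>2$. An $r$-factorization of $\lambda K_m$ can be extended to a connected $s$-factorization of $\lambda K_n$ if and only if (i) $(m,r,\lambda)$ and $(n,s,\lambda)$ are $2$-admissible; (ii) $1<s/r\le (n-1)/(m-1)$; (iii) $n\ge 2m$ if $s/r<(n-1)/(m-1)$.
   Context: $\lambda K_n$ is the loopless multigraph on $n$ vertices with every pair joined by $\lambda$ edges; $\lambda K_m$ is its subgraph induced on a fixed set of $m$ vertices. An $r$-factor is a spanning subgraph with all degrees $r$; an $r$-factorization is a partition of the edges into $r$-factors. An $r$-factorization of $\lambda K_m$ extends to a connected $s$-factorization of $\lambda K_n$ if there is a partition of the edges of $\lambda K_n$ into connected $s$-factors such that each given $r$-factor is contained in one of them and distinct $r$-factors are contained in distinct $s$-factors. $(n,r,\lambda)$ is $2$-admissible if $2\mid rn$ and $r\mid\lambda(n-1)$. *)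

theory Defs
  imports Complex_Main "HOL-Library.Disjoint_Sets" "HOL-Library.FuncSet"
begin

(* An edge of a loopless multigraph is its set of two end vertices together with a
   label that tells parallel edges apart.  A spanning subgraph of a graph with vertex
   set V is identified with its set of edges. *)
type_synonym 'a medge = "'a set \<times> nat"

definition complete_multigraph :: "nat \<Rightarrow> 'a set \<Rightarrow> 'a medge set" where
  "complete_multigraph lam V = {e. e \<subseteq> V \<and> card e = 2} \<times> {..<lam}"

definition induced_edges :: "'a set \<Rightarrow> 'a medge set \<Rightarrow> 'a medge set" where
  "induced_edges M E = {e \<in> E. fst e \<subseteq> M}"

lemma induced_complete_multigraph:
  "M \<subseteq> V \<Longrightarrow> induced_edges M (complete_multigraph lam V) = complete_multigraph lam M"
  by (auto simp: induced_edges_def complete_multigraph_def)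

definition degree :: "'a medge set \<Rightarrow> 'a \<Rightarrow> nat" where
  "degree E v = card {e \<in> E. v \<in> fst e}"

definition adj_rel :: "'a medge set \<Rightarrow> 'a rel" where
  "adj_rel E = {(u, v). \<exists>e\<in>E. fst e = {u, v}}"

definition connected_multigraph :: "'a set \<Rightarrow> 'a medge set \<Rightarrow> bool" where
  "connected_multigraph V E \<longleftrightarrow> V \<noteq> {} \<and> (\<forall>u\<in>V. \<forall>v\<in>V. (u, v) \<in> (adj_rel E)\<^sup>*)"

definition is_factor :: "nat \<Rightarrow> 'a set \<Rightarrow> 'a medge set \<Rightarrow> 'a medge set \<Rightarrow> bool" where
  "is_factor r V E F \<longleftrightarrow> F \<subseteq> E \<and> (\<forall>v\<in>V. degree F v = r)"

definition factorization :: "nat \<Rightarrow> 'a set \<Rightarrow> 'a medge set \<Rightarrow> 'a medge set set \<Rightarrow> bool" where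
  "factorization r V E P \<longleftrightarrow> partition_on E P \<and> (\<forall>F\<in>P. is_factor r V E F)"

(* The injection f sends each given factor to the s-factor that contains it. *)
definition extends_to_connected_factorization ::
  "nat \<Rightarrow> 'a set \<Rightarrow> 'a medge set \<Rightarrow> 'a medge set set \<Rightarrow> bool" where
  "extends_to_connected_factorization s V E P \<longleftrightarrow>
     (\<exists>Q. factorization s V E Q \<and> (\<forall>H\<in>Q. connected_multigraph V H) \<and>
       (\<exists>f \<in> P \<rightarrow> Q. inj_on f P \<and> (\<forall>F\<in>P. F \<subseteq> f F)))"

(* Only used for n > 0, so the subtraction does not truncate. *)
definition two_admissible :: "nat \<Rightarrow> nat \<Rightarrow> nat \<Rightarrow> bool" where
  "two_admissible n r lam \<longleftrightarrow> 2 dvd r * n \<and> r dvd lam * (n - 1)"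

end

theory Submission
  imports Defs
begin

text \<open>
  Necessity is degree counting; an $s$-factor containing none of the given factors has no edge inside
  $M$, so the $sm$ edges leaving $M$ force $n - m \<ge> m$.

  For sufficiency, collapse $V \setminus M$ to one vertex $\alpha$. Each vertex of $M$ sends $s - r$
  edges of a colour $j$ to $\alpha$ if $j$ extends a given factor and $s$ edges otherwise, and
  the remaining edges become loops at $\alpha$. Then split vertices off $\alpha$ one at a
  time. If $\alpha$ still stands for $h$ vertices, the edges handed to the new vertex are found by rounding
  the fractional choice that takes the share $1/h$ of every edge end at $\alpha$. This choice is a circulation in a
  network with arcs for the colours, the components of each colour away from $\alpha$, the vertices and the loops,
  so an integral rounding keeps all degrees and multiplicities exact and takes at most
  $\lceil x/h \rceil$ of the $x$ edges between $\alpha$ and a component. The latter preserves the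
  invariant that every such component sends at least two edges to $\alpha$ while $h \ge 2$, which
  makes the final factors connected.
\<close>

section \<open>Integral rounding of circulations\<close>

text \<open>Degrees and multiplicities are linear conditions, connectivity is not; it is traded for
  a linear condition, a lower bound on the number of edges from each component to \<alpha>. The
  bound is two because a component with a single edge to \<alpha> may lose it, as
  \<lceil>1/h\<rceil> = 1, whereas x \<ge> 2 edges are never all taken when h \<ge> 2, as
  \<lceil>x/h\<rceil> < x. The hypothesis r < s provides the two edges at the start. Once h = 1,
  \<alpha> is itself a vertex of the graph and one edge suffices, hence the bound
  \<open>min 2 h\<close> in the invariant. All constraints can be rounded at once because they form
  two laminar families on the bundles of edges at \<alpha>: in one, bundles are grouped into
  components and these into colours; in the other, they are grouped by their end in
  \<open>D\<close>, with the loops as one further group. A network can carry two such families, one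
  on the way out of its root and one on the way back.\<close>

lemma homogeneous_system_nontrivial_solution:
  fixes c :: "'w \<Rightarrow> 'e \<Rightarrow> real"
  assumes "finite W" "finite F" "card W < card F"
  shows "\<exists>z. (\<exists>e\<in>F. z e \<noteq> 0) \<and> (\<forall>w\<in>W. (\<Sum>e\<in>F. c w e * z e) = 0)"
  using assms
proof (induction W arbitrary: F c rule: finite_induct)
  case empty
  then have "F \<noteq> {}" by auto
  then show ?case by (intro exI[of _ "\<lambda>_. 1"]) auto
next
  case (insert w W)
  show ?case
  proof (cases "\<forall>e\<in>F. c w e = 0")
    case True
    have "card W < card F" using insert by simp
    then obtain z where "\<exists>e\<in>F. z e \<noteq> 0" "\<forall>w\<in>W. (\<Sum>e\<in>F. c w e * z e) = 0"
      using insert.IH[OF insert.prems(1)] by blast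
    then show ?thesis using True by (intro exI[of _ z]) simp
  next
    case False
    then obtain e0 where e0: "e0 \<in> F" "c w e0 \<noteq> 0" by blast
    define F' where "F' = F - {e0}"
    \<comment> \<open>\<open>c'\<close> is the system left after eliminating the unknown
      \<open>e0\<close> by means of equation \<open>w\<close>; \<open>y\<close> below is the value
      of \<open>e0\<close> found by back substitution.\<close>
    define c' where "c' = (\<lambda>w' e. c w' e - c w' e0 * c w e / c w e0)"
    have F': "finite F'" "card W < card F'" "e0 \<notin> F'"
      using insert e0 by (auto simp: F'_def)
    obtain z where z: "\<exists>e\<in>F'. z e \<noteq> 0" "\<forall>w'\<in>W. (\<Sum>e\<in>F'. c' w' e * z e) = 0"
      using insert.IH[OF F'(1,2), of c'] by blast
    define y where "y = - (\<Sum>e\<in>F'. c w e * z e) / c w e0"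
    define z' where "z' = z(e0 := y)"
    have eq: "(\<Sum>e\<in>F. c w' e * z' e) = c w' e0 * y + (\<Sum>e\<in>F'. c w' e * z e)" for w'
    proof -
      have "(\<Sum>e\<in>F. c w' e * z' e) = c w' e0 * z' e0 + (\<Sum>e\<in>F'. c w' e * z' e)"
        unfolding F'_def using insert.prems(1) e0(1) by (rule sum.remove)
      also have "(\<Sum>e\<in>F'. c w' e * z' e) = (\<Sum>e\<in>F'. c w' e * z e)"
        using F'(3) by (intro sum.cong) (auto simp: z'_def)
      finally show ?thesis by (simp add: z'_def)
    qed
    have "(\<Sum>e\<in>F. c w' e * z' e) = 0" if "w' \<in> insert w W" for w'
    proof (cases "w' = w")
      case True
      then show ?thesis unfolding eq using e0 by (simp add: y_def)
    next
      case False
      then have "(\<Sum>e\<in>F'. c' w' e * z e) = 0" using z that by simp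
      moreover have "(\<Sum>e\<in>F'. c' w' e * z e)
          = (\<Sum>e\<in>F'. c w' e * z e) - (c w' e0 / c w e0) * (\<Sum>e\<in>F'. c w e * z e)"
        by (simp add: c'_def sum_subtractf sum_distrib_left left_diff_distrib mult.assoc)
      ultimately show ?thesis unfolding eq by (simp add: y_def)
    qed
    moreover have "\<exists>e\<in>F. z' e \<noteq> 0"
      using z(1) by (auto simp: z'_def F'_def)
    ultimately show ?thesis by blast
  qed
qed

text \<open>The value type is left open so that fractional and integral flows share one predicate.
  Every element of the node type counts as a node; those without arcs satisfy the law
  trivially.\<close>

definition conserves :: "'e set \<Rightarrow> ('e \<Rightarrow> 'v) \<Rightarrow> ('e \<Rightarrow> 'v) \<Rightarrow> ('e \<Rightarrow> 'b::comm_monoid_add) \<Rightarrow> bool"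
  where "conserves E src dst f \<longleftrightarrow>
    (\<forall>v. (\<Sum>e\<in>{e\<in>E. src e = v}. f e) = (\<Sum>e\<in>{e\<in>E. dst e = v}. f e))"

text \<open>A node cannot meet just one end of a non-integral arc, since all other terms of its
  conservation law are integers. So the non-integral arcs \<open>F\<close> touch at most
  \<open>card F\<close> nodes. One conservation law is redundant, which leaves fewer equations than
  unknowns; this replaces the search for a cycle of non-integral arcs.\<close>

lemma nonintegral_circulation_direction:
  fixes f :: "'e \<Rightarrow> real"
  assumes E: "finite E" and cons: "conserves E src dst f"
    and ne: "{e\<in>E. f e \<notin> \<int>} \<noteq> {}"
  shows "\<exists>z::'e \<Rightarrow> real. conserves E src dst z \<and> (\<forall>e\<in>E. f e \<in> \<int> \<longrightarrow> z e = 0) \<and> (\<exists>e\<in>E. z e \<noteq> 0)"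
proof -
  define F where "F = {e\<in>E. f e \<notin> \<int>}"
  define W where "W = src ` F \<union> dst ` F"
  let ?T = "\<lambda>v. {e\<in>F. src e = v}" and ?H = "\<lambda>v. {e\<in>F. dst e = v}"
  have fin: "finite F" "finite W" using E by (auto simp: F_def W_def)
  have deg2: "card (?T v) + card (?H v) \<ge> 2" if v: "v \<in> W" for v
  proof (rule ccontr)
    assume "\<not> ?thesis"
    then have lt: "card (?T v) + card (?H v) < 2" by simp
    have split: "(\<Sum>e\<in>{e\<in>E. p e = v}. f e) - (\<Sum>e\<in>{e\<in>F. p e = v}. f e) \<in> \<int>" for p
    proof -
      have "(\<Sum>e\<in>{e\<in>E. p e = v}. f e) - (\<Sum>e\<in>{e\<in>F. p e = v}. f e)
          = (\<Sum>e\<in>{e\<in>E. p e = v} - {e\<in>F. p e = v}. f e)"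
        using E by (subst sum_diff) (auto simp: F_def)
      also have "\<dots> \<in> \<int>" by (intro Ints_sum) (auto simp: F_def)
      finally show ?thesis .
    qed
    have "((\<Sum>e\<in>{e\<in>E. src e = v}. f e) - (\<Sum>e\<in>?T v. f e)) - ((\<Sum>e\<in>{e\<in>E. dst e = v}. f e) - (\<Sum>e\<in>?H v. f e)) \<in> \<int>"
      using split[of src] split[of dst] by (rule Ints_diff)
    then have int: "(\<Sum>e\<in>?H v. f e) - (\<Sum>e\<in>?T v. f e) \<in> \<int>"
      using cons by (simp add: conserves_def)
    have "?T v \<noteq> {} \<or> ?H v \<noteq> {}" using v by (auto simp: W_def)
    then have "card (?T v) + card (?H v) \<noteq> 0" using fin by auto
    with lt have "(card (?T v) = 1 \<and> card (?H v) = 0) \<or> (card (?T v) = 0 \<and> card (?H v) = 1)"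
      by linarith
    then obtain e where e: "(?T v = {e} \<and> ?H v = {}) \<or> (?T v = {} \<and> ?H v = {e})"
      using fin by (auto simp: card_1_singleton_iff)
    then have "e \<in> F" by blast
    moreover have "f e \<in> \<int>"
      using e
    proof (elim disjE conjE)
      assume "?T v = {e}" "?H v = {}"
      with int show ?thesis by (simp only: sum.empty sum.insert) (simp add: minus_in_Ints_iff)
    next
      assume "?T v = {}" "?H v = {e}"
      with int show ?thesis by (simp only: sum.empty) simp
    qed
    ultimately show False by (simp add: F_def)
  qed
  have cardsum: "(\<Sum>v\<in>W. card {e\<in>F. p e = v}) = card F" if "p ` F \<subseteq> W" for p
    using sum.group[OF fin that, of "\<lambda>_. 1::nat"] by simp
  have "2 * card W = (\<Sum>v\<in>W. 2)" by simp
  also have "\<dots> \<le> (\<Sum>v\<in>W. card (?T v) + card (?H v))" using deg2 by (rule sum_mono)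
  also have "\<dots> = 2 * card F"
    unfolding sum.distrib by (subst (1 2) cardsum) (auto simp: W_def)
  finally have le: "card W \<le> card F" by simp
  \<comment> \<open>Each arc of \<open>F\<close> has both ends in \<open>W\<close> and contributes
    once with each sign, so the equations over \<open>W\<close> add up to zero and the one at
    \<open>v0\<close> follows from the others.\<close>
  obtain v0 where v0: "v0 \<in> W" using ne by (auto simp: W_def F_def)
  then have lt: "card (W - {v0}) < card F"
    using le fin by (metis card_Diff1_less less_le_trans)
  define c where "c = (\<lambda>v e. of_bool (src e = v) - of_bool (dst e = v) :: real)"
  obtain z where z: "\<exists>e\<in>F. z e \<noteq> 0" "\<forall>v\<in>W - {v0}. (\<Sum>e\<in>F. c v e * z e) = 0"
    using homogeneous_system_nontrivial_solution[OF _ fin(1) lt, of c] fin by auto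
  have "(\<Sum>v\<in>W. c v e) = 0" if "e \<in> F" for e
    using that fin by (auto simp: c_def sum_subtractf W_def of_bool_def)
  then have "(\<Sum>v\<in>W. \<Sum>e\<in>F. c v e * z e) = 0"
    by (subst sum.swap) (simp flip: sum_distrib_right)
  moreover have "(\<Sum>v\<in>W. \<Sum>e\<in>F. c v e * z e)
      = (\<Sum>e\<in>F. c v0 e * z e) + (\<Sum>v\<in>W-{v0}. \<Sum>e\<in>F. c v e * z e)"
    using fin(2) v0 by (rule sum.remove)
  ultimately have "(\<Sum>e\<in>F. c v0 e * z e) = 0" using z(2) by simp
  with z(2) have zW: "(\<Sum>e\<in>F. c v e * z e) = 0" if "v \<in> W" for v using that by blast
  define z' where "z' = (\<lambda>e. if e \<in> F then z e else 0)"
  have red: "(\<Sum>e\<in>{e\<in>E. p e = v}. z' e) = (\<Sum>e\<in>F. of_bool (p e = v) * z e)" for p v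
  proof -
    have "(\<Sum>e\<in>{e\<in>E. p e = v}. z' e) = (\<Sum>e\<in>{e\<in>F. p e = v}. z e)"
      using E by (intro sum.mono_neutral_cong_right) (auto simp: z'_def F_def)
    also have "\<dots> = (\<Sum>e\<in>F. of_bool (p e = v) * z e)"
      using fin by (intro sum.mono_neutral_cong_left) auto
    finally show ?thesis .
  qed
  have "conserves E src dst z'" unfolding conserves_def
  proof
    fix v
    have "(\<Sum>e\<in>F. c v e * z e) = 0"
    proof (cases "v \<in> W")
      case False
      then show ?thesis by (intro sum.neutral) (auto simp: c_def W_def)
    qed (rule zW)
    then show "(\<Sum>e\<in>{e\<in>E. src e = v}. z' e) = (\<Sum>e\<in>{e\<in>E. dst e = v}. z' e)"
      unfolding red by (simp add: c_def left_diff_distrib sum_subtractf)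
  qed
  moreover have "\<exists>e\<in>E. z' e \<noteq> 0" using z(1) by (auto simp: z'_def F_def)
  moreover have "\<forall>e\<in>E. f e \<in> \<int> \<longrightarrow> z' e = 0" by (auto simp: z'_def F_def)
  ultimately show ?thesis by blast
qed

text \<open>Move \<open>f\<close> along a direction \<open>z\<close> until the first arc reaches an
  integer. Integral arcs stay put and no arc passes its floor or ceiling, so the number of
  non-integral arcs drops while the original bounds persist.\<close>

theorem integral_circulation_rounding:
  fixes f :: "'e \<Rightarrow> real"
  assumes "finite E" "conserves E src dst f"
  shows "\<exists>g::'e \<Rightarrow> int. conserves E src dst g \<and> (\<forall>e\<in>E. \<lfloor>f e\<rfloor> \<le> g e \<and> g e \<le> \<lceil>f e\<rceil>)"
  using assms(2)
proof (induction "card {e\<in>E. f e \<notin> \<int>}" arbitrary: f rule: less_induct)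
  case less
  show ?case
  proof (cases "{e\<in>E. f e \<notin> \<int>} = {}")
    case True
    then have int: "real_of_int \<lfloor>f e\<rfloor> = f e" if "e \<in> E" for e
      using that by (metis (mono_tags, lifting) Ints_cases empty_Collect_eq floor_of_int)
    have "conserves E src dst (\<lambda>e. \<lfloor>f e\<rfloor>)" unfolding conserves_def
    proof
      fix v
      have "real_of_int (\<Sum>e\<in>{e\<in>E. src e = v}. \<lfloor>f e\<rfloor>) = real_of_int (\<Sum>e\<in>{e\<in>E. dst e = v}. \<lfloor>f e\<rfloor>)"
        using less.prems by (simp add: int conserves_def)
      then show "(\<Sum>e\<in>{e\<in>E. src e = v}. \<lfloor>f e\<rfloor>) = (\<Sum>e\<in>{e\<in>E. dst e = v}. \<lfloor>f e\<rfloor>)"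
        by (simp only: of_int_eq_iff)
    qed
    then show ?thesis by (intro exI[of _ "\<lambda>e. \<lfloor>f e\<rfloor>"]) (simp add: floor_le_ceiling)
  next
    case False
    obtain z :: "'e \<Rightarrow> real" where z: "conserves E src dst z" "\<forall>e\<in>E. f e \<in> \<int> \<longrightarrow> z e = 0" "\<exists>e\<in>E. z e \<noteq> 0"
      using nonintegral_circulation_direction[OF assms(1) less.prems False] by blast
    define G where "G = {e\<in>E. z e \<noteq> 0}"
    \<comment> \<open>\<open>bd e\<close> is the integer ahead of \<open>f e\<close> in direction
      \<open>z\<close>, and \<open>\<tau> e\<close> is the time at which it is reached.\<close>
    define bd where "bd = (\<lambda>e. if z e > 0 then real_of_int \<lceil>f e\<rceil> else real_of_int \<lfloor>f e\<rfloor>)"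
    define \<tau> where "\<tau> = (\<lambda>e. (bd e - f e) / z e)"
    have G: "finite G" "G \<noteq> {}" using assms(1) z(3) by (auto simp: G_def)
    define t where "t = Min (\<tau> ` G)"
    have "t \<in> \<tau> ` G" unfolding t_def using G by (intro Min_in) auto
    then obtain e0 where e0: "e0 \<in> G" "t = \<tau> e0" by blast
    have t_le: "t \<le> \<tau> e" if "e \<in> G" for e using G that by (simp add: t_def)
    have "\<tau> e \<ge> 0" for e
    proof (cases "z e > 0")
      case True then show ?thesis by (auto simp: \<tau>_def bd_def)
    next
      case False then show ?thesis by (auto simp: \<tau>_def bd_def divide_simps)
    qed
    then have t0: "t \<ge> 0" using e0 by simp
    define f' where "f' = (\<lambda>e. f e + t * z e)"
    have bounds: "real_of_int \<lfloor>f e\<rfloor> \<le> f' e \<and> f' e \<le> real_of_int \<lceil>f e\<rceil>" if "e \<in> E" for e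
    proof (cases "z e" "0::real" rule: linorder_cases)
      case equal
      then show ?thesis by (simp add: f'_def)
    next
      case greater
      then have "t * z e \<le> real_of_int \<lceil>f e\<rceil> - f e"
        using t_le[of e] that by (simp add: G_def \<tau>_def bd_def pos_le_divide_eq)
      moreover have "0 \<le> t * z e" using t0 greater by simp
      ultimately show ?thesis using of_int_floor_le[of "f e"] unfolding f'_def by linarith
    next
      case less
      then have "t * z e \<ge> real_of_int \<lfloor>f e\<rfloor> - f e"
        using t_le[of e] that by (simp add: G_def \<tau>_def bd_def neg_le_divide_eq)
      moreover have "0 \<ge> t * z e" using t0 less by (simp add: mult_le_0_iff)
      ultimately show ?thesis using le_of_int_ceiling[of "f e"] unfolding f'_def by linarith
    qed
    have "f' e0 = bd e0" using e0 by (simp add: f'_def \<tau>_def G_def)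
    then have "f' e0 \<in> \<int>" by (simp add: bd_def)
    then have "{e\<in>E. f' e \<notin> \<int>} \<subset> {e\<in>E. f e \<notin> \<int>}"
      using e0(1) z(2) by (auto simp: f'_def G_def)
    then have "card {e\<in>E. f' e \<notin> \<int>} < card {e\<in>E. f e \<notin> \<int>}"
      using assms(1) by (intro psubset_card_mono) auto
    moreover have "conserves E src dst f'"
      using less.prems z(1) by (simp add: conserves_def f'_def sum.distrib flip: sum_distrib_left)
    ultimately obtain g :: "'e \<Rightarrow> int" where g: "conserves E src dst g"
        "\<forall>e\<in>E. \<lfloor>f' e\<rfloor> \<le> g e \<and> g e \<le> \<lceil>f' e\<rceil>"
      using less.hyps by blast
    have "\<lfloor>f e\<rfloor> \<le> g e \<and> g e \<le> \<lceil>f e\<rceil>" if "e \<in> E" for e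
      using bounds[OF that] g(2) that by (meson ceiling_le le_floor_iff order_trans)
    with g(1) show ?thesis by blast
  qed
qed

section \<open>Balanced selection of edges at the amalgamated vertex\<close>

text \<open>Flow runs from \<open>Root\<close> to a colour, from there through a component to a
  vertex or directly to \<open>Loops\<close>, and back to \<open>Root\<close>. The amounts on
  \<open>Edge j u\<close> and \<open>Loop j\<close> say how many edges of that bundle are handed to
  the new vertex.\<close>

datatype ('a, 'c) node = Root | Colour nat | Class nat 'c | Vertex 'a | Loops

datatype ('a, 'c) arc =
  To_Colour nat | To_Class nat 'c | Edge nat 'a | Loop nat | From_Vertex 'a | From_Loops

fun arc_src :: "(nat \<Rightarrow> 'a \<Rightarrow> 'c) \<Rightarrow> ('a, 'c) arc \<Rightarrow> ('a, 'c) node" where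
  "arc_src \<kappa> (To_Colour j) = Root"
| "arc_src \<kappa> (To_Class j c) = Colour j"
| "arc_src \<kappa> (Edge j u) = Class j (\<kappa> j u)"
| "arc_src \<kappa> (Loop j) = Colour j"
| "arc_src \<kappa> (From_Vertex u) = Vertex u"
| "arc_src \<kappa> From_Loops = Loops"

fun arc_dst :: "('a, 'c) arc \<Rightarrow> ('a, 'c) node" where
  "arc_dst (To_Colour j) = Colour j"
| "arc_dst (To_Class j c) = Class j c"
| "arc_dst (Edge j u) = Vertex u"
| "arc_dst (Loop j) = Loops"
| "arc_dst (From_Vertex u) = Root"
| "arc_dst From_Loops = Root"

definition arcs :: "nat \<Rightarrow> 'a set \<Rightarrow> (nat \<Rightarrow> 'a \<Rightarrow> 'c) \<Rightarrow> ('a, 'c) arc set" where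
  "arcs q D \<kappa> = To_Colour ` {..<q} \<union> (\<Union>j<q. To_Class j ` \<kappa> j ` D) \<union> (\<Union>j<q. Edge j ` D)
     \<union> Loop ` {..<q} \<union> From_Vertex ` D \<union> {From_Loops}"

lemma finite_arcs: "finite D \<Longrightarrow> finite (arcs q D \<kappa>)"
  by (auto simp: arcs_def)

lemma all_node_iff:
  "(\<forall>v. P v) \<longleftrightarrow> P Root \<and> (\<forall>j. P (Colour j)) \<and> (\<forall>j c. P (Class j c)) \<and> (\<forall>u. P (Vertex u)) \<and> P Loops"
  (is "?L \<longleftrightarrow> ?R")
proof
  assume R: ?R
  show ?L
  proof
    fix v
    show "P v" using R by (cases v) auto
  qed
qed blast

text \<open>Colours from \<open>q\<close> on, labels that do not occur and vertices outside
  \<open>D\<close> are isolated nodes and impose nothing, so one equation for each node in use is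
  left.\<close>

lemma conserves_arcs_iff:
  assumes "finite D"
  shows "conserves (arcs q D \<kappa>) (arc_src \<kappa>) arc_dst g \<longleftrightarrow>
    (\<Sum>j<q. g (To_Colour j)) = (\<Sum>u\<in>D. g (From_Vertex u)) + g From_Loops \<and>
    (\<forall>j<q. (\<Sum>c\<in>\<kappa> j ` D. g (To_Class j c)) + g (Loop j) = g (To_Colour j)) \<and>
    (\<forall>j<q. \<forall>c\<in>\<kappa> j ` D. (\<Sum>u\<in>{u\<in>D. \<kappa> j u = c}. g (Edge j u)) = g (To_Class j c)) \<and>
    (\<forall>u\<in>D. g (From_Vertex u) = (\<Sum>j<q. g (Edge j u))) \<and>
    g From_Loops = (\<Sum>j<q. g (Loop j))"
    (is "?L \<longleftrightarrow> ?root \<and> ?col \<and> ?class \<and> ?vertex \<and> ?loops")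
proof -
  let ?A = "arcs q D \<kappa>"
  let ?out = "\<lambda>v. \<Sum>e\<in>{e\<in>?A. arc_src \<kappa> e = v}. g e"
  let ?in = "\<lambda>v. \<Sum>e\<in>{e\<in>?A. arc_dst e = v}. g e"
  have "?out Root = (\<Sum>j<q. g (To_Colour j))"
    by (rule sum.reindex_cong[of To_Colour]) (auto simp: arcs_def inj_on_def)
  moreover have "?in Root = (\<Sum>u\<in>D. g (From_Vertex u)) + g From_Loops"
  proof -
    have "{e\<in>?A. arc_dst e = Root} = From_Vertex ` D \<union> {From_Loops}"
      by (auto simp: arcs_def)
    then show ?thesis
      using assms by (simp add: sum.reindex inj_on_def image_iff add.commute)
  qed
  ultimately have root: "(?out Root = ?in Root) = ?root" by simp
  have col_out: "?out (Colour j) = (\<Sum>c\<in>\<kappa> j ` D. g (To_Class j c)) + g (Loop j)" if "j < q" for j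
  proof -
    have "{e\<in>?A. arc_src \<kappa> e = Colour j} = To_Class j ` \<kappa> j ` D \<union> {Loop j}"
      using that by (fastforce simp: arcs_def)
    moreover have "sum g (To_Class j ` \<kappa> j ` D) = (\<Sum>c\<in>\<kappa> j ` D. g (To_Class j c))"
      by (subst sum.reindex) (auto simp: inj_on_def)
    moreover have "sum g (insert (Loop j) (To_Class j ` \<kappa> j ` D)) = g (Loop j) + sum g (To_Class j ` \<kappa> j ` D)"
      using assms by (intro sum.insert) auto
    ultimately show ?thesis by (simp add: add.commute)
  qed
  have col_in: "?in (Colour j) = g (To_Colour j)" if "j < q" for j
  proof -
    have "{e\<in>?A. arc_dst e = Colour j} = {To_Colour j}" using that by (auto simp: arcs_def)
    then show ?thesis by simp
  qed
  have col_none: "?out (Colour j) = ?in (Colour j)" if "\<not> j < q" for j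
  proof -
    have "{e\<in>?A. arc_dst e = Colour j} = {}" "{e\<in>?A. arc_src \<kappa> e = Colour j} = {}"
      using that by (auto simp: arcs_def)
    then show ?thesis by (simp only:)
  qed
  have class_out: "?out (Class j c) = (\<Sum>u\<in>{u\<in>D. \<kappa> j u = c}. g (Edge j u))" if "j < q" for j c
    using that by (intro sum.reindex_cong[of "Edge j"]) (auto simp: arcs_def inj_on_def)
  have class_in: "?in (Class j c) = g (To_Class j c)" if "j < q" "c \<in> \<kappa> j ` D" for j c
  proof -
    have "{e\<in>?A. arc_dst e = Class j c} = {To_Class j c}"
      using that by (fastforce simp: arcs_def)
    then show ?thesis by simp
  qed
  have class_none: "?out (Class j c) = ?in (Class j c)" if "\<not> (j < q \<and> c \<in> \<kappa> j ` D)" for j c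
  proof -
    have "{e\<in>?A. arc_dst e = Class j c} = {}" "{e\<in>?A. arc_src \<kappa> e = Class j c} = {}"
      using that by (auto simp: arcs_def)
    then show ?thesis by (simp only:)
  qed
  have vertex_in: "?in (Vertex u) = (\<Sum>j<q. g (Edge j u))" if "u \<in> D" for u
    using that by (intro sum.reindex_cong[of "\<lambda>j. Edge j u"]) (auto simp: arcs_def inj_on_def)
  have vertex_out: "?out (Vertex u) = g (From_Vertex u)" if "u \<in> D" for u
  proof -
    have "{e\<in>?A. arc_src \<kappa> e = Vertex u} = {From_Vertex u}" using that by (auto simp: arcs_def)
    then show ?thesis by simp
  qed
  have vertex_none: "?out (Vertex u) = ?in (Vertex u)" if "u \<notin> D" for u
  proof -
    have "{e\<in>?A. arc_dst e = Vertex u} = {}" "{e\<in>?A. arc_src \<kappa> e = Vertex u} = {}"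
      using that by (auto simp: arcs_def)
    then show ?thesis by (simp only:)
  qed
  have loops_in: "?in Loops = (\<Sum>j<q. g (Loop j))"
    by (rule sum.reindex_cong[of Loop]) (auto simp: arcs_def inj_on_def)
  have loops_out: "?out Loops = g From_Loops"
  proof -
    have "{e\<in>?A. arc_src \<kappa> e = Loops} = {From_Loops}" by (auto simp: arcs_def)
    then show ?thesis by simp
  qed
  have col: "(?out (Colour j) = ?in (Colour j)) \<longleftrightarrow>
      (j < q \<longrightarrow> (\<Sum>c\<in>\<kappa> j ` D. g (To_Class j c)) + g (Loop j) = g (To_Colour j))" for j
  proof (cases "j < q")
    case True
    then show ?thesis unfolding col_out[OF True] col_in[OF True] by blast
  next
    case False
    then show ?thesis using col_none by blast
  qed
  have "class": "(?out (Class j c) = ?in (Class j c)) \<longleftrightarrow>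
      (j < q \<longrightarrow> c \<in> \<kappa> j ` D \<longrightarrow> (\<Sum>u\<in>{u\<in>D. \<kappa> j u = c}. g (Edge j u)) = g (To_Class j c))" for j c
  proof (cases "j < q \<and> c \<in> \<kappa> j ` D")
    case True
    then have jc: "j < q" "c \<in> \<kappa> j ` D" by simp_all
    show ?thesis unfolding class_out[OF jc(1)] class_in[OF jc] using jc by simp
  next
    case False
    then show ?thesis using class_none by blast
  qed
  have vertex: "(?out (Vertex u) = ?in (Vertex u)) \<longleftrightarrow>
      (u \<in> D \<longrightarrow> g (From_Vertex u) = (\<Sum>j<q. g (Edge j u)))" for u
  proof (cases "u \<in> D")
    case True
    then show ?thesis unfolding vertex_out[OF True] vertex_in[OF True] by blast
  next
    case False
    then show ?thesis using vertex_none by blast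
  qed
  show ?thesis
    unfolding conserves_def all_node_iff root col "class" vertex loops_in loops_out Ball_def by blast
qed

text \<open>The arcs at \<open>Root\<close> carry the integers \<open>s\<close>, \<open>lam\<close>
  and \<open>lam * (h - 1)\<close>, which rounding cannot change; this gives the three equations.
  The last property is the bound \<lceil>x/h\<rceil> for a class, written without division. The
  labelling \<open>\<kappa>\<close> is arbitrary here and is later the component of a
  vertex.\<close>

lemma balanced_selection:
  fixes a :: "nat \<Rightarrow> 'a \<Rightarrow> nat" and l :: "nat \<Rightarrow> nat" and \<kappa> :: "nat \<Rightarrow> 'a \<Rightarrow> 'c"
  assumes D: "finite D" and h: "h \<ge> 2"
    and alpha_sum: "\<And>u. u \<in> D \<Longrightarrow> (\<Sum>j<q. a j u) = lam * h"
    and loop_sum: "2 * (\<Sum>j<q. l j) = lam * h * (h - 1)"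
    and alpha_deg: "\<And>j. j < q \<Longrightarrow> (\<Sum>u\<in>D. a j u) + 2 * l j = s * h"
  obtains b :: "nat \<Rightarrow> 'a \<Rightarrow> nat" and t :: "nat \<Rightarrow> nat" where
    "\<And>j. j < q \<Longrightarrow> (\<Sum>u\<in>D. b j u) + t j = s"
    "\<And>u. u \<in> D \<Longrightarrow> (\<Sum>j<q. b j u) = lam"
    "(\<Sum>j<q. t j) = lam * (h - 1)"
    "\<And>j u. j < q \<Longrightarrow> u \<in> D \<Longrightarrow> b j u \<le> a j u"
    "\<And>j. j < q \<Longrightarrow> t j \<le> l j"
    "\<And>j c. j < q \<Longrightarrow> h * (\<Sum>u\<in>{u\<in>D. \<kappa> j u = c}. b j u) < (\<Sum>u\<in>{u\<in>D. \<kappa> j u = c}. a j u) + h"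
proof -
  \<comment> \<open>A loop has two ends at \<alpha>, hence the factor 2. \<open>From_Loops\<close>
    carries the edges that must join the new vertex to the \<open>h - 1\<close> vertices still
    amalgamated.\<close>
  define f :: "('a, 'c) arc \<Rightarrow> real" where "f = (\<lambda>e. case e of
      To_Colour j \<Rightarrow> real s
    | To_Class j c \<Rightarrow> real (\<Sum>u\<in>{u\<in>D. \<kappa> j u = c}. a j u) / real h
    | Edge j u \<Rightarrow> real (a j u) / real h
    | Loop j \<Rightarrow> real (2 * l j) / real h
    | From_Vertex u \<Rightarrow> real lam
    | From_Loops \<Rightarrow> real (lam * (h - 1)))"
  have h0: "real h > 0" using h by simp
  have class_sum: "(\<Sum>c\<in>\<kappa> j ` D. \<Sum>u\<in>{u\<in>D. \<kappa> j u = c}. x u) = (\<Sum>u\<in>D. x u)"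
    for j and x :: "'a \<Rightarrow> 'b::comm_monoid_add"
    using D by (intro sum.group) auto
  \<comment> \<open>Multiplied by \<open>h\<close>, both sides count the edge ends at \<alpha>, once
    by colour and once by the other end.\<close>
  have root: "q * s = card D * lam + lam * (h - 1)"
  proof -
    have "(\<Sum>j<q. (\<Sum>u\<in>D. a j u) + 2 * l j) = (\<Sum>j<q. s * h)"
      using alpha_deg by simp
    moreover have "(\<Sum>j<q. (\<Sum>u\<in>D. a j u) + 2 * l j) = (\<Sum>u\<in>D. \<Sum>j<q. a j u) + 2 * (\<Sum>j<q. l j)"
      by (subst sum.swap) (simp add: sum.distrib sum_distrib_left)
    moreover have "(\<Sum>u\<in>D. \<Sum>j<q. a j u) = card D * (lam * h)"
      using alpha_sum by simp
    ultimately have "h * (q * s) = h * (card D * lam + lam * (h - 1))"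
      using loop_sum by (simp add: algebra_simps)
    then show ?thesis using h by simp
  qed
  have "conserves (arcs q D \<kappa>) (arc_src \<kappa>) arc_dst f"
    unfolding conserves_arcs_iff[OF D]
  proof (intro conjI allI impI ballI)
    show "(\<Sum>j<q. f (To_Colour j)) = (\<Sum>u\<in>D. f (From_Vertex u)) + f From_Loops"
      using root by (simp add: f_def flip: of_nat_mult of_nat_add)
  next
    fix j assume "j < q"
    have "(\<Sum>c\<in>\<kappa> j ` D. f (To_Class j c)) = real (\<Sum>u\<in>D. a j u) / real h"
      by (simp add: f_def class_sum flip: sum_divide_distrib of_nat_sum)
    then have "(\<Sum>c\<in>\<kappa> j ` D. f (To_Class j c)) + f (Loop j) = real (s * h) / real h"
      unfolding alpha_deg[OF \<open>j < q\<close>, symmetric] by (simp add: f_def add_divide_distrib)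
    then show "(\<Sum>c\<in>\<kappa> j ` D. f (To_Class j c)) + f (Loop j) = f (To_Colour j)"
      using h0 by (simp add: f_def)
  next
    fix j c
    show "(\<Sum>u\<in>{u\<in>D. \<kappa> j u = c}. f (Edge j u)) = f (To_Class j c)"
      by (simp add: f_def sum_divide_distrib)
  next
    fix u assume "u \<in> D"
    have "(\<Sum>j<q. f (Edge j u)) = real (\<Sum>j<q. a j u) / real h"
      by (simp add: f_def sum_divide_distrib)
    then show "f (From_Vertex u) = (\<Sum>j<q. f (Edge j u))"
      using alpha_sum[OF \<open>u \<in> D\<close>] h0 by (simp add: f_def)
  next
    have "(\<Sum>j<q. f (Loop j)) = real (2 * (\<Sum>j<q. l j)) / real h"
      by (simp add: f_def sum_divide_distrib sum_distrib_left)
    then show "f From_Loops = (\<Sum>j<q. f (Loop j))"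
      using h0 unfolding loop_sum by (simp add: f_def)
  qed
  then obtain g :: "('a, 'c) arc \<Rightarrow> int" where
    g: "conserves (arcs q D \<kappa>) (arc_src \<kappa>) arc_dst g" and
    round: "\<And>e. e \<in> arcs q D \<kappa> \<Longrightarrow> \<lfloor>f e\<rfloor> \<le> g e \<and> g e \<le> \<lceil>f e\<rceil>"
    using integral_circulation_rounding[OF finite_arcs[OF D]] by blast
  note g = g[unfolded conserves_arcs_iff[OF D]]
  define b where "b = (\<lambda>j u. nat (g (Edge j u)))"
  define t where "t = (\<lambda>j. nat (g (Loop j)))"
  have nonneg: "g e \<ge> 0" if "e \<in> arcs q D \<kappa>" for e
  proof -
    have "f e \<ge> 0" by (cases e) (simp_all add: f_def sum_nonneg)
    then show ?thesis using round[OF that] by (meson order_trans zero_le_floor)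
  qed
  have b: "int (b j u) = g (Edge j u)" if "j < q" "u \<in> D" for j u
    using that nonneg[of "Edge j u"] by (auto simp: b_def arcs_def)
  have t: "int (t j) = g (Loop j)" if "j < q" for j
    using that nonneg[of "Loop j"] by (auto simp: t_def arcs_def)
  have exact: "g e = k" if "e \<in> arcs q D \<kappa>" "f e = of_int k" for e k
    using round[OF that(1)] that(2) by simp
  have g_col: "g (To_Colour j) = int s" if "j < q" for j
    using that by (intro exact) (auto simp: arcs_def f_def)
  have g_vertex: "g (From_Vertex u) = int lam" if "u \<in> D" for u
    using that by (intro exact) (auto simp: arcs_def f_def)
  have g_loops: "g From_Loops = int (lam * (h - 1))"
    by (intro exact) (auto simp: arcs_def f_def)
  have upper: "real_of_int (g e) < f e + 1" if "e \<in> arcs q D \<kappa>" for e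
    using round[OF that] by linarith
  show thesis
  proof
    fix j assume j: "j < q"
    have "(\<Sum>c\<in>\<kappa> j ` D. g (To_Class j c)) = (\<Sum>c\<in>\<kappa> j ` D. \<Sum>u\<in>{u\<in>D. \<kappa> j u = c}. g (Edge j u))"
      using g j by (intro sum.cong) auto
    also have "\<dots> = (\<Sum>u\<in>D. g (Edge j u))" by (rule class_sum)
    finally have "(\<Sum>u\<in>D. g (Edge j u)) + g (Loop j) = g (To_Colour j)" using g j by metis
    then have "int ((\<Sum>u\<in>D. b j u) + t j) = int s"
      using j g_col by (simp add: b t)
    then show "(\<Sum>u\<in>D. b j u) + t j = s" by (simp only: of_nat_eq_iff)
  next
    fix u assume u: "u \<in> D"
    then have "int (\<Sum>j<q. b j u) = int lam" using g g_vertex by (simp add: b)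
    then show "(\<Sum>j<q. b j u) = lam" by (simp only: of_nat_eq_iff)
  next
    have "int (\<Sum>j<q. t j) = int (lam * (h - 1))" using g g_loops by (simp add: t)
    then show "(\<Sum>j<q. t j) = lam * (h - 1)" by (simp only: of_nat_eq_iff)
  next
    fix j u assume ju: "j < q" "u \<in> D"
    then have "real_of_int (g (Edge j u)) < real (a j u) / real h + 1"
      using upper[of "Edge j u"] by (auto simp: arcs_def f_def)
    also have "\<dots> \<le> real (a j u) + 1"
    proof -
      have "real (a j u) * 1 \<le> real (a j u) * real h" using h by (intro mult_left_mono) auto
      then show ?thesis using h0 by (simp add: pos_divide_le_eq)
    qed
    finally show "b j u \<le> a j u" using b[OF ju] by linarith
  next
    fix j assume j: "j < q"
    then have "real_of_int (g (Loop j)) < real (2 * l j) / real h + 1"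
      using upper[of "Loop j"] by (auto simp: arcs_def f_def)
    \<comment> \<open>The share \<open>2 * l j / h\<close> is at most \<open>l j\<close> only
      because \<open>h \<ge> 2\<close>; rounding up then cannot demand more loops than there
      are.\<close>
    also have "\<dots> \<le> real (l j) + 1"
    proof -
      have "real (l j) * 2 \<le> real (l j) * real h" using h by (intro mult_left_mono) auto
      then show ?thesis using h0 by (simp add: pos_divide_le_eq)
    qed
    finally show "t j \<le> l j" using t[OF j] by linarith
  next
    fix j c assume j: "j < q"
    let ?K = "{u\<in>D. \<kappa> j u = c}"
    show "h * (\<Sum>u\<in>?K. b j u) < (\<Sum>u\<in>?K. a j u) + h"
    proof (cases "c \<in> \<kappa> j ` D")
      case True
      then have "(\<Sum>u\<in>?K. g (Edge j u)) = g (To_Class j c)" using g j by blast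
      then have "int (\<Sum>u\<in>?K. b j u) = g (To_Class j c)" using j by (simp add: b)
      moreover have "real_of_int (g (To_Class j c)) < real (\<Sum>u\<in>?K. a j u) / real h + 1"
      proof -
        have "To_Class j c \<in> arcs q D \<kappa>" using j True unfolding arcs_def by blast
        from upper[OF this] show ?thesis by (simp add: f_def)
      qed
      ultimately have "real (\<Sum>u\<in>?K. b j u) < real (\<Sum>u\<in>?K. a j u) / real h + 1"
        by linarith
      then have "real h * real (\<Sum>u\<in>?K. b j u) < real h * (real (\<Sum>u\<in>?K. a j u) / real h + 1)"
        using h0 by (intro mult_strict_left_mono)
      also have "\<dots> = real (\<Sum>u\<in>?K. a j u) + real h"
        using h0 by (simp add: distrib_left del: of_nat_sum)
      finally have "real h * real (\<Sum>u\<in>?K. b j u) < real (\<Sum>u\<in>?K. a j u) + real h" .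
      then show ?thesis by (simp only: of_nat_less_iff flip: of_nat_mult of_nat_add)
    next
      case False
      then have "?K = {}" by auto
      then show ?thesis using h by (simp only:) simp
    qed
  qed
qed

section \<open>Detaching vertices\<close>

text \<open>
  The vertices outside \<open>D\<close> are amalgamated into one vertex $\alpha$ standing for \<open>h\<close> of them.
  In colour \<open>j\<close> there are \<open>w j u v\<close> edges between \<open>u\<close> and \<open>v\<close>, \<open>a j u\<close> edges between \<open>u\<close> and
  $\alpha$, and \<open>l j\<close> loops at $\alpha$, each counting twice in the degree of $\alpha$.
\<close>

locale amalgam =
  fixes q s lam h :: nat and D :: "'a set"
    and w :: "nat \<Rightarrow> 'a \<Rightarrow> 'a \<Rightarrow> nat" and a :: "nat \<Rightarrow> 'a \<Rightarrow> nat" and l :: "nat \<Rightarrow> nat"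
  assumes finite_D: "finite D" and s: "s \<ge> 2" and h: "h \<ge> 1"
    and w_diag: "\<And>j u. j < q \<Longrightarrow> u \<in> D \<Longrightarrow> w j u u = 0"
    and w_sym: "\<And>j u v. j < q \<Longrightarrow> u \<in> D \<Longrightarrow> v \<in> D \<Longrightarrow> w j u v = w j v u"
    and w_sum: "\<And>u v. u \<in> D \<Longrightarrow> v \<in> D \<Longrightarrow> u \<noteq> v \<Longrightarrow> (\<Sum>j<q. w j u v) = lam"
    and a_sum: "\<And>u. u \<in> D \<Longrightarrow> (\<Sum>j<q. a j u) = lam * h"
    and l_sum: "2 * (\<Sum>j<q. l j) = lam * h * (h - 1)"
    and deg: "\<And>j u. j < q \<Longrightarrow> u \<in> D \<Longrightarrow> (\<Sum>v\<in>D. w j u v) + a j u = s"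
    and alpha_deg: "\<And>j. j < q \<Longrightarrow> (\<Sum>u\<in>D. a j u) + 2 * l j = s * h"
    and cut: "\<And>j C. j < q \<Longrightarrow> C \<subseteq> D \<Longrightarrow> C \<noteq> {} \<Longrightarrow> (\<And>u v. u \<in> C \<Longrightarrow> v \<in> D - C \<Longrightarrow> w j u v = 0)
      \<Longrightarrow> min 2 h \<le> (\<Sum>u\<in>C. a j u)"
begin

text \<open>Closed sets are the unions of components of colour \<open>j\<close>. Deleting the newest
  vertex from a component may break it into several, but what remains is closed in the old graph, so
  the induction runs over closed sets.\<close>

definition closed :: "nat \<Rightarrow> 'a set \<Rightarrow> bool" where
  "closed j C \<longleftrightarrow> C \<subseteq> D \<and> (\<forall>u\<in>C. \<forall>v\<in>D - C. w j u v = 0)"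

definition component :: "nat \<Rightarrow> 'a \<Rightarrow> 'a set" where
  "component j u = {(x, y). x \<in> D \<and> y \<in> D \<and> w j x y > 0}\<^sup>* `` {u}"

lemma component_refl: "u \<in> component j u"
  by (simp add: component_def)

lemma component_eq:
  assumes "j < q" "v \<in> component j u"
  shows "component j v = component j u"
proof -
  let ?R = "{(x, y). x \<in> D \<and> y \<in> D \<and> w j x y > 0}"
  have "sym ?R" using w_sym[OF assms(1)] by (auto simp: sym_def)
  then have "sym (?R\<^sup>*)" by (rule sym_rtrancl)
  moreover have uv: "(u, v) \<in> ?R\<^sup>*" using assms by (simp add: component_def)
  ultimately have vu: "(v, u) \<in> ?R\<^sup>*" by (rule symD)
  have "(v, x) \<in> ?R\<^sup>* \<longleftrightarrow> (u, x) \<in> ?R\<^sup>*" for x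
    using rtrancl_trans[OF uv, of x] rtrancl_trans[OF vu, of x] by blast
  then show ?thesis unfolding component_def Image_singleton by (simp only:)
qed

lemma component_subset:
  assumes "closed j C" "u \<in> C"
  shows "component j u \<subseteq> C"
proof
  fix v assume "v \<in> component j u"
  then have "(u, v) \<in> {(x, y). x \<in> D \<and> y \<in> D \<and> w j x y > 0}\<^sup>*" by (simp add: component_def)
  then show "v \<in> C"
    by induction (use assms in \<open>auto simp: closed_def dest: gr_implies_not0\<close>)
qed

lemma closed_D: "closed j D"
  by (simp add: closed_def)

lemma closed_component:
  assumes "j < q" "u \<in> D"
  shows "closed j (component j u)"
proof -
  have "w j x y = 0" if "x \<in> component j u" "y \<in> D - component j u" for x y
  proof (rule ccontr)
    assume "w j x y \<noteq> 0"
    moreover have "x \<in> D" using that component_subset[OF closed_D assms(2)] by blast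
    ultimately have "(x, y) \<in> {(x, y). x \<in> D \<and> y \<in> D \<and> w j x y > 0}" using that by auto
    then have "y \<in> component j u"
      using that by (auto simp: component_def intro: rtrancl_into_rtrancl)
    with that show False by blast
  qed
  then show ?thesis using component_subset[OF closed_D assms(2)] by (auto simp: closed_def)
qed

lemma closed_Diff:
  assumes "j < q" "closed j C" "closed j K"
  shows "closed j (C - K)"
  unfolding closed_def
proof (intro conjI ballI)
  show "C - K \<subseteq> D" using assms by (auto simp: closed_def)
next
  fix u v assume uv: "u \<in> C - K" "v \<in> D - (C - K)"
  show "w j u v = 0"
  proof (cases "v \<in> C")
    case True
    with uv have "v \<in> K" "u \<in> D - K" using assms by (auto simp: closed_def)
    then have "w j v u = 0" using assms by (auto simp: closed_def)
    then show ?thesis using w_sym[OF assms(1)] uv assms(2) by (auto simp: closed_def)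
  next
    case False
    with uv assms show ?thesis by (auto simp: closed_def)
  qed
qed

lemma cut_closed: "j < q \<Longrightarrow> closed j C \<Longrightarrow> C \<noteq> {} \<Longrightarrow> min 2 h \<le> (\<Sum>u\<in>C. a j u)"
  by (rule cut) (auto simp: closed_def)

text \<open>
  Here \<open>b u\<close> and \<open>t\<close> are the numbers of edges \<open>u\<close>-$\alpha$ and of loops handed to the new vertex; the
  conclusion bounds the number of edges from $\alpha$ to the component that absorbs the new vertex.
\<close>

lemma detach_remainder:
  assumes j: "j < q" and h2: "h \<ge> 2" and C: "closed j C"
    and le: "\<And>u. u \<in> D \<Longrightarrow> b u \<le> a j u"
    and comp: "\<And>u. u \<in> D \<Longrightarrow>
      h * (\<Sum>v\<in>component j u. b v) < (\<Sum>v\<in>component j u. a j v) + h"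
    and total: "(\<Sum>u\<in>C. b u) + t = s"
  shows "min 2 (h - 1) \<le> (\<Sum>u\<in>C. a j u - b u) + t"
proof (cases "t \<ge> 2")
  \<comment> \<open>Each loop handed over becomes an edge from the new vertex to \<alpha>, so two of
    them settle the claim.\<close>
  case True
  then show ?thesis by simp
next
  case False
  let ?r = "\<lambda>K. \<Sum>u\<in>K. a j u - b u"
  have finC: "finite C" and CD: "C \<subseteq> D" using C finite_D by (auto simp: closed_def finite_subset)
  have r_eq: "?r K = (\<Sum>u\<in>K. a j u) - (\<Sum>u\<in>K. b u)" if "K \<subseteq> C" for K
    using that le CD by (intro sum_subtractf_nat) auto
  have split: "sum f C = sum f K + sum f (C - K)" if "K \<subseteq> C" for K and f :: "'a \<Rightarrow> nat"
    using sum.subset_diff[OF that finC, of f] by simp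
  have one: "?r (component j u) \<ge> 1" if u: "u \<in> C" for u
  proof -
    let ?K = "component j u"
    have K: "?K \<subseteq> C" using C u by (rule component_subset)
    have "2 \<le> (\<Sum>v\<in>?K. a j v)"
      using cut_closed[OF j closed_component[OF j]] u CD component_refl[of u j] h2 by force
    moreover have "h * (\<Sum>v\<in>?K. b v) < (\<Sum>v\<in>?K. a j v) + h" using comp u CD by blast
    \<comment> \<open>Were \<open>b \<ge> a'\<close>, the bound would give
      \<open>(h - 1) * a' < h\<close>, which fails for \<open>a' \<ge> 2\<close> and
      \<open>h \<ge> 2\<close>. So a component always keeps an edge to \<alpha>.\<close>
    moreover have "b \<le> a' - 1" if "h * b < a' + h" "2 \<le> a'" for a' b :: nat
    proof (rule ccontr)
      assume "\<not> ?thesis"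
      then have "h * a' \<le> h * b" by (intro mult_le_mono2) linarith
      moreover obtain k where k: "h = Suc k" "k \<ge> 1" using h2 by (cases h) auto
      moreover have "k * 2 \<le> k * a'" using that by (intro mult_le_mono2)
      moreover have "h * a' = a' + k * a'" using k by simp
      ultimately show False using that by linarith
    qed
    ultimately have "(\<Sum>v\<in>?K. b v) \<le> (\<Sum>v\<in>?K. a j v) - 1" "2 \<le> (\<Sum>v\<in>?K. a j v)" by blast+
    then show ?thesis unfolding r_eq[OF K] by linarith
  qed
  \<comment> \<open>Since \<open>t < 2 \<le> s\<close>, the new vertex has a neighbour in
    \<open>C\<close>, so \<open>C\<close> contains a component.\<close>
  have "(\<Sum>u\<in>C. b u) > 0" using False total s by linarith
  then obtain u where u: "u \<in> C" by fastforce
  let ?K = "component j u"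
  have K: "?K \<subseteq> C" using C u by (rule component_subset)
  show ?thesis
  proof (cases "t = 1 \<or> h = 2")
    case True
    have "1 \<le> ?r C" using one[OF u] split[OF K, of "\<lambda>u. a j u - b u"] by linarith
    then show ?thesis using True by auto
  next
    case False
    then have h3: "h \<ge> 3" and t0: "t = 0" using h2 \<open>\<not> t \<ge> 2\<close> by auto
    \<comment> \<open>If \<open>C\<close> is a single component, all \<open>s\<close> edges of the
      new vertex came from its edges to \<alpha>, of which there were more than
      \<open>3 * (s - 1)\<close>, so at least \<open>2 * s - 2\<close> remain. Otherwise
      \<open>C\<close> contains two components and each keeps one.\<close>
    have "2 \<le> ?r C"
    proof (cases "C = ?K")
      case True
      have "h * (\<Sum>v\<in>C. b v) < (\<Sum>v\<in>C. a j v) + h" 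
        using comp[OF subsetD[OF CD u]] by (simp flip: True)
      moreover have "(\<Sum>v\<in>C. b v) = s" using total t0 by simp
      ultimately have "h * s < (\<Sum>v\<in>C. a j v) + h" by simp
      moreover have "h * s = h * (s - 1) + h" using s by (simp add: algebra_simps)
      ultimately have "h * (s - 1) < (\<Sum>v\<in>C. a j v)" by linarith
      moreover have "3 * (s - 1) \<le> h * (s - 1)" using h3 by simp
      ultimately show ?thesis
        unfolding r_eq[OF order_refl] using \<open>(\<Sum>v\<in>C. b v) = s\<close> s by linarith
    next
      case False
      then obtain v where v: "v \<in> C - ?K" using K by blast
      have "closed j (C - ?K)"
        using closed_Diff[OF j C] closed_component[OF j] u CD by blast
      then have K2: "component j v \<subseteq> C - ?K" using v by (rule component_subset)
      then have "?r (component j v) \<le> ?r (C - ?K)"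
        using finC by (intro sum_mono2) auto
      then show ?thesis
        using one[OF u] one[of v] v split[OF K, of "\<lambda>u. a j u - b u"] by simp
    qed
    then show ?thesis by simp
  qed
qed

text \<open>The \<open>b j u\<close> selected edges move their end from \<alpha> to
  \<open>v\<close>. Of each of the \<open>t j\<close> selected loops one end moves, so that it turns
  into an edge between \<open>v\<close> and \<alpha>.\<close>

lemma detach_vertex:
  assumes h2: "h \<ge> 2" and v: "v \<notin> D"
  obtains w' a' l' where "amalgam q s lam (h - 1) (insert v D) w' a' l'"
    and "\<And>j x y. x \<in> D \<Longrightarrow> y \<in> D \<Longrightarrow> w' j x y = w j x y"
proof -
  obtain b :: "nat \<Rightarrow> 'a \<Rightarrow> nat" and t :: "nat \<Rightarrow> nat" where
    b_deg: "\<And>j. j < q \<Longrightarrow> (\<Sum>u\<in>D. b j u) + t j = s" and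
    b_sum: "\<And>u. u \<in> D \<Longrightarrow> (\<Sum>j<q. b j u) = lam" and
    t_sum: "(\<Sum>j<q. t j) = lam * (h - 1)" and
    b_le: "\<And>j u. j < q \<Longrightarrow> u \<in> D \<Longrightarrow> b j u \<le> a j u" and
    t_le: "\<And>j. j < q \<Longrightarrow> t j \<le> l j" and
    b_comp: "\<And>j c. j < q \<Longrightarrow> h * (\<Sum>u\<in>{u\<in>D. component j u = c}. b j u)
      < (\<Sum>u\<in>{u\<in>D. component j u = c}. a j u) + h"
    using balanced_selection[OF finite_D h2 a_sum l_sum alpha_deg, of component] by blast
  have comp_set: "{x\<in>D. component j x = component j u} = component j u" if "j < q" "u \<in> D" for j u
  proof (intro set_eqI iffI)
    fix x assume "x \<in> {x\<in>D. component j x = component j u}"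
    then show "x \<in> component j u" using component_refl[of x j] by simp
  next
    fix x assume "x \<in> component j u"
    then show "x \<in> {x\<in>D. component j x = component j u}"
      using component_eq[OF that(1)] component_subset[OF closed_D that(2)] by simp blast
  qed
  define w' where "w' = (\<lambda>j x y. if x = v then (if y = v then 0 else b j y)
    else if y = v then b j x else w j x y)"
  define a' where "a' = (\<lambda>j x. if x = v then t j else a j x - b j x)"
  define l' where "l' = (\<lambda>j. l j - t j)"
  have old: "w' j x y = w j x y" if "x \<in> D" "y \<in> D" for j x y
    using that v by (auto simp: w'_def)
  have new: "w' j v x = b j x" "w' j x v = b j x" "a' j x = a j x - b j x" if "x \<in> D" for j x
    using that v by (auto simp: w'_def a'_def)
  note [simp] = old new
  have [simp]: "w' j v v = 0" "a' j v = t j" for j by (auto simp: w'_def a'_def)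
  have a'_total: "(\<Sum>u\<in>D. a' j u) + (\<Sum>u\<in>D. b j u) = (\<Sum>u\<in>D. a j u)" if "j < q" for j
    using that b_le by (simp flip: sum.distrib)
  have "amalgam q s lam (h - 1) (insert v D) w' a' l'"
  proof
    show "finite (insert v D)" using finite_D by simp
    show "s \<ge> 2" by (rule s)
    show "h - 1 \<ge> 1" using h2 by simp
  next
    fix j u assume "j < q" "u \<in> insert v D"
    then show "w' j u u = 0" using w_diag by auto
  next
    fix j x y assume "j < q" "x \<in> insert v D" "y \<in> insert v D"
    then show "w' j x y = w' j y x" using w_sym by auto
  next
    fix x y assume "x \<in> insert v D" "y \<in> insert v D" "x \<noteq> y"
    then show "(\<Sum>j<q. w' j x y) = lam" using w_sum b_sum by auto
  next
    fix u assume u: "u \<in> insert v D"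
    show "(\<Sum>j<q. a' j u) = lam * (h - 1)"
    proof (cases "u = v")
      case True
      then show ?thesis using t_sum by simp
    next
      case False
      then have uD: "u \<in> D" using u by simp
      have "(\<Sum>j<q. a' j u) = (\<Sum>j<q. a j u) - (\<Sum>j<q. b j u)"
        unfolding new(3)[OF uD] using uD b_le by (intro sum_subtractf_nat) auto
      then show ?thesis using a_sum[OF uD] b_sum[OF uD] by (simp add: diff_mult_distrib2)
    qed
  next
    have "(\<Sum>j<q. l' j) = (\<Sum>j<q. l j) - (\<Sum>j<q. t j)"
      unfolding l'_def using t_le by (intro sum_subtractf_nat) auto
    then have "2 * (\<Sum>j<q. l' j) = lam * h * (h - 1) - 2 * (lam * (h - 1))"
      using l_sum t_sum by simp
    also have "\<dots> = lam * (h - 1) * (h - 1 - 1)"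
    proof -
      obtain k where "h = 2 + k" using h2 by (rule less_eqE)
      then show ?thesis by (simp add: algebra_simps)
    qed
    finally show "2 * (\<Sum>j<q. l' j) = lam * (h - 1) * (h - 1 - 1)" .
  next
    fix j u assume j: "j < q" and u: "u \<in> insert v D"
    show "(\<Sum>y\<in>insert v D. w' j u y) + a' j u = s"
    proof (cases "u = v")
      case True
      then show ?thesis using b_deg[OF j] finite_D v by simp
    next
      case False
      then have uD: "u \<in> D" using u by simp
      then show ?thesis using deg[OF j uD] b_le[OF j uD] finite_D v by simp
    qed
  next
    fix j assume j: "j < q"
    have "s * (h - 1) = s * h - s" by (simp add: diff_mult_distrib2)
    then show "(\<Sum>u\<in>insert v D. a' j u) + 2 * l' j = s * (h - 1)"
      using alpha_deg[OF j] b_deg[OF j] a'_total[OF j] t_le[OF j] finite_D v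
      by (simp add: l'_def del: new)
  next
    fix j C assume j: "j < q" and C: "C \<subseteq> insert v D" "C \<noteq> {}"
      and closed': "\<And>x y. x \<in> C \<Longrightarrow> y \<in> insert v D - C \<Longrightarrow> w' j x y = 0"
    have CD: "C - {v} \<subseteq> D" using C by blast
    have cl: "closed j (C - {v})"
      unfolding closed_def
    proof (intro conjI ballI)
      fix x y assume "x \<in> C - {v}" "y \<in> D - (C - {v})"
      then show "w j x y = 0" using closed'[of x y] CD v by auto
    qed (rule CD)
    \<comment> \<open>A closed set without \<open>v\<close> contains no neighbour of
      \<open>v\<close> in colour \<open>j\<close>, so it keeps all its edges to \<alpha>. A closed
      set with \<open>v\<close> contains all neighbours of \<open>v\<close> in \<open>D\<close>,
      which is the situation of \<open>detach_remainder\<close>.\<close>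
    show "min 2 (h - 1) \<le> (\<Sum>u\<in>C. a' j u)"
    proof (cases "v \<in> C")
      case False
      then have eq: "C - {v} = C" by simp
      have "b j x = 0" if "x \<in> C" for x using closed'[of x v] that False CD eq by auto
      then have "(\<Sum>u\<in>C. a' j u) = (\<Sum>u\<in>C. a j u)"
        using CD eq by (intro sum.cong) auto
      moreover have "min 2 h \<le> (\<Sum>u\<in>C. a j u)" using cut_closed[OF j] cl eq C by simp
      ultimately show ?thesis by linarith
    next
      case True
      let ?B = "C - {v}"
      have "b j x = 0" if "x \<in> D - ?B" for x using closed'[of v x] that True v by auto
      then have "(\<Sum>u\<in>?B. b j u) = (\<Sum>u\<in>D. b j u)"
        using finite_D CD by (intro sum.mono_neutral_left) auto
      then have total: "(\<Sum>u\<in>?B. b j u) + t j = s" using b_deg[OF j] by simp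
      have "min 2 (h - 1) \<le> (\<Sum>u\<in>?B. a j u - b j u) + t j"
      proof (rule detach_remainder[OF j h2 cl _ _ total])
        fix u assume u: "u \<in> D"
        show "b j u \<le> a j u" using j u by (rule b_le)
        show "h * (\<Sum>x\<in>component j u. b j x) < (\<Sum>x\<in>component j u. a j x) + h"
          using b_comp[OF j, of "component j u"] unfolding comp_set[OF j u] .
      qed
      moreover have "(\<Sum>u\<in>C. a' j u) = a' j v + (\<Sum>u\<in>?B. a' j u)"
        using True C finite_D by (intro sum.remove) (auto intro: finite_subset)
      moreover have "(\<Sum>u\<in>?B. a' j u) = (\<Sum>u\<in>?B. a j u - b j u)"
        using CD by (intro sum.cong) auto
      ultimately show ?thesis by simp
    qed
  qed
  then show thesis by (rule that) simp
qed

end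

text \<open>Only multiplicities are recorded; labels of parallel edges come later. Connectivity is
  expressed by cuts, the form in which the invariant delivers it.\<close>

definition connected_colouring :: "nat \<Rightarrow> nat \<Rightarrow> nat \<Rightarrow> 'a set \<Rightarrow> (nat \<Rightarrow> 'a \<Rightarrow> 'a \<Rightarrow> nat) \<Rightarrow> bool" where
  "connected_colouring q s lam V w \<longleftrightarrow>
    (\<forall>j<q. \<forall>u\<in>V. w j u u = 0) \<and>
    (\<forall>j<q. \<forall>u\<in>V. \<forall>v\<in>V. w j u v = w j v u) \<and>
    (\<forall>u\<in>V. \<forall>v\<in>V. u \<noteq> v \<longrightarrow> (\<Sum>j<q. w j u v) = lam) \<and>
    (\<forall>j<q. \<forall>u\<in>V. (\<Sum>v\<in>V. w j u v) = s) \<and>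
    (\<forall>j<q. \<forall>C\<subseteq>V. C \<noteq> {} \<longrightarrow> (\<forall>u\<in>C. \<forall>v\<in>V - C. w j u v = 0) \<longrightarrow> C = V)"

text \<open>For \<open>h = 1\<close> the loop count \<open>lam * h * (h - 1) / 2\<close> vanishes,
  so \<alpha> can simply be renamed \<open>v\<close>. The invariant, now with bound one, says that
  every nonempty closed subset of \<open>D\<close> has an edge to \<open>v\<close>.\<close>

lemma (in amalgam) detach_last_vertex:
  assumes h1: "h = 1" and v: "v \<notin> D"
  obtains w' where "connected_colouring q s lam (insert v D) w'"
    and "\<And>j x y. x \<in> D \<Longrightarrow> y \<in> D \<Longrightarrow> w' j x y = w j x y"
proof -
  have l0: "l j = 0" if "j < q" for j using l_sum that h1 by simp
  define w' where "w' = (\<lambda>j x y. if x = v then (if y = v then 0 else a j y)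
    else if y = v then a j x else w j x y)"
  have old[simp]: "w' j x y = w j x y" if "x \<in> D" "y \<in> D" for j x y
    using that v by (auto simp: w'_def)
  have new[simp]: "w' j v x = a j x" "w' j x v = a j x" if "x \<in> D" for j x
    using that v by (auto simp: w'_def)
  have [simp]: "w' j v v = 0" for j by (auto simp: w'_def)
  have nocut: False if j: "j < q" and C: "C \<subseteq> D" "C \<noteq> {}"
    and cl: "\<And>x y. x \<in> C \<Longrightarrow> y \<in> insert v D - C \<Longrightarrow> w' j x y = 0" for j C
  proof -
    have "w j x y = 0" if "x \<in> C" "y \<in> D - C" for x y
      using cl[of x y] that C by auto
    then have "min 2 h \<le> (\<Sum>u\<in>C. a j u)" using cut[OF j C] by blast
    moreover have "a j x = 0" if "x \<in> C" for x
    proof -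
      have "x \<in> D" "v \<notin> C" using that C v by auto
      then show ?thesis using cl[of x v] that by simp
    qed
    ultimately show False using h1 by simp
  qed
  have sym: "w' j x y = w' j y x" if "j < q" "x \<in> insert v D" "y \<in> insert v D" for j x y
    using that w_sym by auto
  have "connected_colouring q s lam (insert v D) w'"
    unfolding connected_colouring_def
  proof (intro conjI allI ballI impI)
    fix j u assume "j < q" "u \<in> insert v D"
    then show "w' j u u = 0" using w_diag by auto
  next
    fix x y assume "x \<in> insert v D" "y \<in> insert v D" "x \<noteq> y"
    then show "(\<Sum>j<q. w' j x y) = lam" using w_sum a_sum h1 by auto
  next
    fix j u assume j: "j < q" and u: "u \<in> insert v D"
    then show "(\<Sum>y\<in>insert v D. w' j u y) = s"
      using alpha_deg[OF j] l0[OF j] deg[OF j] h1 finite_D v by (auto simp: add.commute)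
  next
    fix j C assume j: "j < q" and C: "C \<subseteq> insert v D" "C \<noteq> {}"
      and cl: "\<forall>x\<in>C. \<forall>y\<in>insert v D - C. w' j x y = 0"
    show "C = insert v D"
    proof (cases "v \<in> C")
      case False
      then have "C \<subseteq> D" using C by blast
      then have False by (rule nocut[OF j _ C(2)]) (use cl in auto)
      then show ?thesis ..
    next
      case True
      \<comment> \<open>By symmetry of \<open>w'\<close> the complement of a closed set is closed,
        and here it avoids \<open>v\<close>.\<close>
      let ?B = "insert v D - C"
      have "?B = {}"
      proof (rule ccontr)
        assume "?B \<noteq> {}"
        moreover have "?B \<subseteq> D" using True by blast
        moreover have "w' j x y = 0" if "x \<in> ?B" "y \<in> insert v D - ?B" for x y
        proof -
          have "w' j y x = 0" using that cl by auto
          then show ?thesis using sym[OF j] that by simp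
        qed
        ultimately show False by (intro nocut[OF j, of ?B])
      qed
      then show ?thesis using C by blast
    qed
  qed (rule sym)
  then show thesis by (rule that) simp
qed

text \<open>Agreement with \<open>w\<close> on \<open>D\<close> is carried along because it
  preserves the given factors: no detachment touches an edge between vertices that are already
  separate.\<close>

theorem amalgam_detachment:
  assumes "amalgam q s lam h D w a l" "finite V" "D \<subseteq> V" "card (V - D) = h"
  shows "\<exists>w'. connected_colouring q s lam V w' \<and> (\<forall>j. \<forall>x\<in>D. \<forall>y\<in>D. w' j x y = w j x y)"
  using assms
proof (induction h arbitrary: D w a l)
  case 0
  then show ?case using amalgam.h by fastforce
next
  case (Suc h)
  interpret amalgam q s lam "Suc h" D w a l by (rule Suc.prems)
  have "V - D \<noteq> {}" using Suc.prems(4) by (metis card.empty Zero_not_Suc)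
  then obtain v where v: "v \<in> V - D" by blast
  have "V - insert v D = (V - D) - {v}" by blast
  then have card: "card (V - insert v D) = h"
    using card_Diff_singleton[OF v] Suc.prems(4) by simp
  show ?case
  proof (cases "h = 0")
    case True
    then have "V = insert v D" using card Suc.prems v by auto
    moreover obtain w' where "connected_colouring q s lam (insert v D) w'"
        "\<And>j x y. x \<in> D \<Longrightarrow> y \<in> D \<Longrightarrow> w' j x y = w j x y"
      using detach_last_vertex[of v] True v by auto
    ultimately show ?thesis by blast
  next
    case False
    obtain w' a' l' where am: "amalgam q s lam h (insert v D) w' a' l'"
        and w': "\<And>j x y. x \<in> D \<Longrightarrow> y \<in> D \<Longrightarrow> w' j x y = w j x y"
      using detach_vertex[of v] False v by auto
    have "insert v D \<subseteq> V" using v Suc.prems by blast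
    then obtain w'' where "connected_colouring q s lam V w''"
        "\<forall>j. \<forall>x\<in>insert v D. \<forall>y\<in>insert v D. w'' j x y = w' j x y"
      using Suc.IH[OF am Suc.prems(2) _ card] by blast
    then show ?thesis using w' by (intro exI[of _ w'']) auto
  qed
qed

section \<open>Counting in complete multigraphs\<close>

text \<open>The link between labelled edges and multiplicities, which are all that the detachment
  sees.\<close>

definition edge_mult :: "'a medge set \<Rightarrow> 'a \<Rightarrow> 'a \<Rightarrow> nat" where
  "edge_mult E u v = card {i. ({u, v}, i) \<in> E}"

lemma finite_complete_multigraph: "finite V \<Longrightarrow> finite (complete_multigraph lam V)"
  unfolding complete_multigraph_def by (intro finite_cartesian_product) (auto intro: finite_subset[of _ "Pow V"])

lemma pair_in_complete_multigraph:
  "({u, v}, i) \<in> complete_multigraph lam V \<longleftrightarrow> u \<in> V \<and> v \<in> V \<and> u \<noteq> v \<and> i < lam"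
  by (cases "u = v") (auto simp: complete_multigraph_def)

lemma complete_multigraph_cases:
  assumes "x \<in> complete_multigraph lam V"
  obtains u v i where "x = ({u, v}, i)" "u \<in> V" "v \<in> V" "u \<noteq> v" "i < lam"
  using assms by (auto simp: complete_multigraph_def card_2_iff)

lemma finite_labels: "E \<subseteq> complete_multigraph lam V \<Longrightarrow> finite {i. ({u, v}, i) \<in> E}"
  by (rule finite_subset[of _ "{..<lam}"]) (auto simp: complete_multigraph_def)

lemma edge_mult_self:
  assumes "E \<subseteq> complete_multigraph lam V"
  shows "edge_mult E u u = 0"
proof -
  have "{i. ({u, u}, i) \<in> E} = {}" using assms by (auto simp: complete_multigraph_def)
  then show ?thesis unfolding edge_mult_def by (simp only: card.empty)
qed

lemma edge_mult_commute: "edge_mult E u v = edge_mult E v u"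
  by (simp add: edge_mult_def insert_commute)

lemma edge_mult_complete:
  "u \<in> V \<Longrightarrow> v \<in> V \<Longrightarrow> u \<noteq> v \<Longrightarrow> edge_mult (complete_multigraph lam V) u v = lam"
  by (simp add: edge_mult_def pair_in_complete_multigraph)

lemma edge_mult_pos_iff:
  "E \<subseteq> complete_multigraph lam V \<Longrightarrow> edge_mult E u v > 0 \<longleftrightarrow> (\<exists>i. ({u, v}, i) \<in> E)"
  using finite_labels[of E lam V u v] by (auto simp: edge_mult_def card_gt_0_iff)

lemma degree_eq_sum_edge_mult:
  assumes E: "E \<subseteq> complete_multigraph lam V" and V: "finite V"
  shows "degree E v = (\<Sum>u\<in>V. edge_mult E v u)"
proof -
  have "{e\<in>E. v \<in> fst e} = (\<Union>u\<in>V. Pair {v, u} ` {i. ({v, u}, i) \<in> E})"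
  proof (intro set_eqI iffI)
    fix x assume x: "x \<in> {e\<in>E. v \<in> fst e}"
    then obtain a b i where ab: "x = ({a, b}, i)" "a \<in> V" "b \<in> V"
      using complete_multigraph_cases[of x lam V] E by blast
    with x consider "v = a" | "v = b" by auto
    then obtain u where "u \<in> V" "x = ({v, u}, i)" using ab by cases (auto simp: insert_commute)
    then show "x \<in> (\<Union>u\<in>V. Pair {v, u} ` {i. ({v, u}, i) \<in> E})" using x by blast
  qed auto
  also have "card \<dots> = (\<Sum>u\<in>V. card (Pair {v, u} ` {i. ({v, u}, i) \<in> E}))"
    using V finite_labels[OF E] by (intro card_UN_disjoint) (auto simp: doubleton_eq_iff)
  also have "\<dots> = (\<Sum>u\<in>V. edge_mult E v u)"
    unfolding edge_mult_def by (intro sum.cong refl card_image) (auto simp: inj_on_def)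
  finally show ?thesis by (simp add: degree_def)
qed

lemma degree_complete_multigraph:
  assumes "finite V" "v \<in> V"
  shows "degree (complete_multigraph lam V) v = lam * (card V - 1)"
proof -
  let ?K = "complete_multigraph lam V"
  have "degree ?K v = edge_mult ?K v v + (\<Sum>u\<in>V-{v}. edge_mult ?K v u)"
    using degree_eq_sum_edge_mult[OF order_refl assms(1)] sum.remove[OF assms] by metis
  also have "(\<Sum>u\<in>V-{v}. edge_mult ?K v u) = (\<Sum>u\<in>V-{v}. lam)"
    using assms by (intro sum.cong refl edge_mult_complete) auto
  finally show ?thesis using assms by (simp add: edge_mult_self[OF order_refl] card_Diff_singleton)
qed

text \<open>With all vertices in place of \<open>M\<close> this yields the handshake identity; with
  \<open>M\<close> and its complement it compares the edge ends on the two sides of a cut.\<close>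

lemma sum_degree_eq_sum_card_ends:
  assumes "finite E" "finite M"
  shows "(\<Sum>v\<in>M. degree E v) = (\<Sum>e\<in>E. card (fst e \<inter> M))"
proof -
  have "(\<Sum>v\<in>M. degree E v) = (\<Sum>v\<in>M. \<Sum>e\<in>E. of_bool (v \<in> fst e))"
    using assms by (simp add: degree_def Int_def)
  also have "\<dots> = (\<Sum>e\<in>E. \<Sum>v\<in>M. of_bool (v \<in> fst e))" by (rule sum.swap)
  also have "\<dots> = (\<Sum>e\<in>E. card (fst e \<inter> M))"
    using assms by (simp add: Int_def conj_commute)
  finally show ?thesis .
qed

lemma sum_degree_complete:
  assumes "E \<subseteq> complete_multigraph lam V" "finite V"
  shows "(\<Sum>v\<in>V. degree E v) = 2 * card E"
proof -
  have "finite E" using assms finite_complete_multigraph finite_subset by metis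
  moreover have "card (fst e \<inter> V) = 2" if "e \<in> E" for e
    using that assms(1) by (auto simp: complete_multigraph_def Int_absorb2)
  ultimately show ?thesis using assms by (simp add: sum_degree_eq_sum_card_ends)
qed

lemma factorization_finite:
  "factorization r V E P \<Longrightarrow> finite E \<Longrightarrow> finite P"
  by (auto simp: factorization_def partition_on_def intro: finite_UnionD)

lemma factorization_degree:
  assumes P: "factorization r V E P" and E: "finite E" and v: "v \<in> V"
  shows "card P * r = degree E v"
proof -
  have part: "partition_on E P" using P by (simp add: factorization_def)
  have "{e\<in>E. v \<in> fst e} = (\<Union>F\<in>P. {e\<in>F. v \<in> fst e})"
    using partition_onD1[OF part] by auto
  moreover have "card (\<Union>F\<in>P. {e\<in>F. v \<in> fst e}) = (\<Sum>F\<in>P. degree F v)"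
    unfolding degree_def
  proof (rule card_UN_disjoint)
    show "finite P" using P E by (rule factorization_finite)
    show "\<forall>F\<in>P. finite {e\<in>F. v \<in> fst e}"
      using partition_onD1[OF part] E by (auto intro: finite_subset[of _ E])
    show "\<forall>F\<in>P. \<forall>G\<in>P. F \<noteq> G \<longrightarrow> {e\<in>F. v \<in> fst e} \<inter> {e\<in>G. v \<in> fst e} = {}"
      using partition_onD2[OF part] by (auto simp: disjoint_def)
  qed
  moreover have "(\<Sum>F\<in>P. degree F v) = (\<Sum>F\<in>P. r)"
    using P v by (intro sum.cong) (auto simp: factorization_def is_factor_def)
  ultimately show ?thesis by (simp add: degree_def)
qed

lemma factorization_complete_card:
  assumes "factorization r V (complete_multigraph lam V) P" "finite V" "V \<noteq> {}"
  shows "card P * r = lam * (card V - 1)"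
  using assms factorization_degree[OF assms(1) finite_complete_multigraph]
    degree_complete_multigraph by (metis ex_in_conv)

lemma factorization_nonempty:
  assumes "factorization r V (complete_multigraph lam V) P" "finite V" "card V > 1" "lam > 0"
  shows "P \<noteq> {}"
proof
  assume "P = {}"
  moreover have "V \<noteq> {}" using assms(3) by auto
  ultimately show False using factorization_complete_card[OF assms(1,2)] assms(3,4) by simp
qed

lemma factorization_complete_two_admissible:
  assumes P: "factorization r V (complete_multigraph lam V) P"
    and V: "finite V" "card V > 1" and lam: "lam > 0"
  shows "two_admissible (card V) r lam"
proof -
  have ne: "V \<noteq> {}" using V(2) by auto
  obtain F where F: "F \<in> P" using factorization_nonempty[OF P V lam] by blast
  then have "is_factor r V (complete_multigraph lam V) F" using P by (simp add: factorization_def)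
  then have "2 * card F = r * card V"
    using sum_degree_complete[of F lam V] V(1) by (simp add: is_factor_def mult.commute)
  then have "2 dvd r * card V" by (metis dvd_triv_left)
  moreover have "r dvd lam * (card V - 1)"
    using factorization_complete_card[OF P V(1) ne] by (metis dvd_triv_right)
  ultimately show ?thesis by (simp add: two_admissible_def)
qed

section \<open>Necessity of the conditions\<close>

lemma factor_less_of_connected_extension:
  assumes V: "finite V" and MV: "M \<subset> V" "M \<noteq> {}"
    and F: "is_factor r M (complete_multigraph lam M) F"
    and H: "is_factor s V (complete_multigraph lam V) H" "connected_multigraph V H"
    and FH: "F \<subseteq> H"
  shows "r < s"
proof (rule ccontr)
  assume "\<not> r < s"
  have finH: "finite H"
    using H(1) finite_complete_multigraph[OF V] by (auto simp: is_factor_def intro: finite_subset)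
  \<comment> \<open>If \<open>s \<le> r\<close>, the edges of \<open>F\<close> already exhaust the
    degree of \<open>H\<close> at every vertex of \<open>M\<close>; then no edge of \<open>H\<close>
    leaves \<open>M\<close> and \<open>H\<close> is disconnected.\<close>
  have at_M: "{e\<in>H. u \<in> fst e} = {e\<in>F. u \<in> fst e}" if u: "u \<in> M" for u
  proof (rule sym, rule card_seteq)
    have "degree H u = s" "degree F u = r"
      using u MV F H(1) by (auto simp: is_factor_def)
    then show "card {e\<in>H. u \<in> fst e} \<le> card {e\<in>F. u \<in> fst e}"
      using \<open>\<not> r < s\<close> by (simp add: degree_def)
  qed (use finH FH in auto)
  obtain u v where uv: "u \<in> M" "v \<in> V" "v \<notin> M" using MV by blast
  then have "(u, v) \<in> (adj_rel H)\<^sup>*"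
    using H(2) MV by (auto simp: connected_multigraph_def)
  then have "v \<in> M"
  proof induction
    case base
    show ?case by (rule uv)
  next
    case (step y z)
    then obtain i where "({y, z}, i) \<in> H" by (auto simp: adj_rel_def)
    then have "({y, z}, i) \<in> {e\<in>H. y \<in> fst e}" by simp
    then have "({y, z}, i) \<in> F" unfolding at_M[OF step.IH] by simp
    then show ?case using F by (auto simp: is_factor_def complete_multigraph_def)
  qed
  with uv show False by blast
qed

lemma independent_set_card_le:
  assumes V: "finite V" and MV: "M \<subseteq> V" and s: "s > 0"
    and H: "is_factor s V (complete_multigraph lam V) H"
    and indep: "H \<inter> complete_multigraph lam M = {}"
  shows "2 * card M \<le> card V"
proof -
  have sub: "H \<subseteq> complete_multigraph lam V" using H by (simp add: is_factor_def)
  have fin: "finite H" "finite M" "finite (V - M)"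
    using sub V MV finite_complete_multigraph[OF V] by (auto intro: finite_subset)
  have deg_sum: "(\<Sum>v\<in>A. degree H v) = card A * s" if "A \<subseteq> V" for A
  proof -
    have "(\<Sum>v\<in>A. degree H v) = (\<Sum>v\<in>A. s)"
      using H that by (intro sum.cong) (auto simp: is_factor_def)
    then show ?thesis by simp
  qed
  have "card M * s = (\<Sum>e\<in>H. card (fst e \<inter> M))"
    using deg_sum[OF MV] fin by (simp add: sum_degree_eq_sum_card_ends)
  also have "\<dots> \<le> (\<Sum>e\<in>H. card (fst e \<inter> (V - M)))"
  proof (rule sum_mono)
    fix e assume e: "e \<in> H"
    then obtain u v i where uv: "e = ({u, v}, i)" "u \<in> V" "v \<in> V" "u \<noteq> v" "i < lam"
      using complete_multigraph_cases[of e lam V] sub by blast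
    have "e \<notin> complete_multigraph lam M" using indep e by blast
    then have "\<not> (u \<in> M \<and> v \<in> M)"
      using uv by (simp add: pair_in_complete_multigraph)
    then show "card (fst e \<inter> M) \<le> card (fst e \<inter> (V - M))"
      using uv by (cases "u \<in> M"; cases "v \<in> M") auto
  qed
  also have "\<dots> = card (V - M) * s"
    using deg_sum[of "V - M"] fin by (simp add: sum_degree_eq_sum_card_ends)
  finally have "card M \<le> card (V - M)" using s by simp
  also have "\<dots> = card V - card M" using fin MV by (intro card_Diff_subset)
  finally show ?thesis using card_mono[OF V MV] by simp
qed

text \<open>The upper bound on s/r compares numbers of factors: multiplied by \<open>lam\<close>,
  its two sides are \<open>card P\<close> and \<open>card Q\<close> times \<open>r * s\<close>, and
  \<open>f\<close> embeds \<open>P\<close> in \<open>Q\<close>. Strict inequality means that some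
  \<open>s\<close>-factor is not in the image of \<open>f\<close>.\<close>

lemma extension_necessary:
  assumes r: "r > 0" and s: "s > 0" and lam: "lam > 0"
    and V: "finite V" and MV: "M \<subset> V" and M1: "card M > 1"
    and P: "factorization r M (complete_multigraph lam M) P"
    and ext: "extends_to_connected_factorization s V (complete_multigraph lam V) P"
  shows "two_admissible (card M) r lam" "two_admissible (card V) s lam"
    "r < s" "s * (card M - 1) \<le> r * (card V - 1)"
    "s * (card M - 1) < r * (card V - 1) \<Longrightarrow> 2 * card M \<le> card V"
proof -
  obtain Q f where Q: "factorization s V (complete_multigraph lam V) Q"
    and conn: "\<And>H. H \<in> Q \<Longrightarrow> connected_multigraph V H"
    and f: "f \<in> P \<rightarrow> Q" "inj_on f P" "\<And>F. F \<in> P \<Longrightarrow> F \<subseteq> f F"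
    using ext by (auto simp: extends_to_connected_factorization_def)
  have fM: "finite M" using V MV by (auto intro: finite_subset)
  have Mne: "M \<noteq> {}" "V \<noteq> {}" using M1 MV by auto
  have V1: "card V > 1" using psubset_card_mono[OF V MV] M1 by simp
  have finQ: "finite Q" using factorization_finite[OF Q] V finite_complete_multigraph by blast
  show "two_admissible (card M) r lam"
    using factorization_complete_two_admissible[OF P fM M1 lam] .
  show "two_admissible (card V) s lam"
    using factorization_complete_two_admissible[OF Q V V1 lam] .
  have cP: "card P * r = lam * (card M - 1)"
    using factorization_complete_card[OF P fM Mne(1)] .
  have cQ: "card Q * s = lam * (card V - 1)"
    using factorization_complete_card[OF Q V Mne(2)] .
  have fP: "f ` P \<subseteq> Q" using f(1) by blast
  have card_le: "card P \<le> card Q" using f(2) fP finQ by (rule card_inj_on_le)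
  have lamP: "lam * (s * (card M - 1)) = card P * (r * s)"
    unfolding mult.left_commute[of lam] cP[symmetric] by (simp add: ac_simps)
  have lamQ: "lam * (r * (card V - 1)) = card Q * (r * s)"
    unfolding mult.left_commute[of lam] cQ[symmetric] by (simp add: ac_simps)
  have "lam * (s * (card M - 1)) \<le> lam * (r * (card V - 1))"
    unfolding lamP lamQ using card_le by (rule mult_le_mono1)
  then show "s * (card M - 1) \<le> r * (card V - 1)" using lam by simp
  obtain F where "F \<in> P" using factorization_nonempty[OF P fM M1 lam] by blast
  then show "r < s"
    using factor_less_of_connected_extension[OF V MV Mne(1)] P Q conn f(1,3)
    by (metis PiE factorization_def)
  assume "s * (card M - 1) < r * (card V - 1)"
  then have "lam * (s * (card M - 1)) < lam * (r * (card V - 1))" using lam by simp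
  then have "card P < card Q" unfolding lamP lamQ by simp
  then have "f ` P \<noteq> Q" using card_image[OF f(2)] by auto
  then obtain H where H: "H \<in> Q" "H \<notin> f ` P" using fP by blast
  \<comment> \<open>The given factors cover all edges inside \<open>M\<close>, and each lies in a
    block of \<open>Q\<close> other than \<open>H\<close>.\<close>
  have "H \<inter> complete_multigraph lam M = {}"
  proof (rule ccontr)
    assume "\<not> ?thesis"
    then obtain x where x: "x \<in> H" "x \<in> complete_multigraph lam M" by blast
    then obtain F where F: "F \<in> P" "x \<in> F" using P by (auto simp: factorization_def partition_on_def)
    then have "x \<in> f F" "f F \<in> Q" using f by auto
    moreover have "disjoint Q" using Q by (simp add: factorization_def partition_on_def)
    ultimately have "f F = H" using H(1) x(1) by (auto simp: disjoint_def)
    with H F show False by blast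
  qed
  then show "2 * card M \<le> card V"
    using Q H(1) V MV s by (intro independent_set_card_le[of V M s lam H]) (auto simp: factorization_def)
qed

section \<open>From multiplicities to colourings of labelled edges\<close>

lemma exists_colouring_with_fibre_sizes:
  "(\<Sum>j<q. x j) = lam \<Longrightarrow>
    \<exists>c::nat \<Rightarrow> nat. (\<forall>i<lam. c i < q) \<and> (\<forall>j<q. card {i. i < lam \<and> c i = j} = x j)"
proof (induction q arbitrary: lam)
  case 0
  then show ?case by simp
next
  case (Suc q)
  define lam' where "lam' = (\<Sum>j<q. x j)"
  obtain c :: "nat \<Rightarrow> nat" where c: "\<forall>i<lam'. c i < q" "\<forall>j<q. card {i. i < lam' \<and> c i = j} = x j"
    using Suc.IH[of lam'] by (auto simp: lam'_def)
  have lam: "lam = lam' + x q" using Suc.prems by (simp add: lam'_def)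
  \<comment> \<open>The labels are cut into consecutive intervals; the last colour takes the top
    \<open>x q\<close> of them.\<close>
  define c' where "c' = (\<lambda>i. if i < lam' then c i else q)"
  have "{i. i < lam \<and> c' i = j} = {i. i < lam' \<and> c i = j}" if "j < q" for j
    using that lam by (auto simp: c'_def)
  then have old: "card {i. i < lam \<and> c' i = j} = x j" if "j < q" for j
    using that c(2) by simp
  have "i < lam \<and> c' i = q \<longleftrightarrow> i \<in> {lam'..<lam}" for i
    using c(1)[rule_format, of i] by (cases "i < lam'") (simp_all add: c'_def)
  then have "{i. i < lam \<and> c' i = q} = {lam'..<lam}" by blast
  then have new: "card {i. i < lam \<and> c' i = q} = x q" using lam by simp
  have "\<forall>j<Suc q. card {i. i < lam \<and> c' i = j} = x j"
    using old new by (metis less_SucE)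
  moreover have "\<forall>i<lam. c' i < Suc q" using c(1) by (auto simp: c'_def less_Suc_eq)
  ultimately show ?case by blast
qed

text \<open>Different pairs do not interact, so the labels can be coloured pair by pair. Pairs
  inside \<open>M\<close> keep the colouring \<open>c0\<close>, which has the prescribed
  multiplicities by \<open>c0_card\<close>.\<close>

lemma exists_edge_colouring:
  fixes w :: "nat \<Rightarrow> 'a \<Rightarrow> 'a \<Rightarrow> nat" and c0 :: "'a medge \<Rightarrow> nat"
  assumes sym: "\<And>j u v. j < q \<Longrightarrow> u \<in> V \<Longrightarrow> v \<in> V \<Longrightarrow> w j u v = w j v u"
    and w_sum: "\<And>u v. u \<in> V \<Longrightarrow> v \<in> V \<Longrightarrow> u \<noteq> v \<Longrightarrow> (\<Sum>j<q. w j u v) = lam"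
    and c0_less: "\<And>x. x \<in> complete_multigraph lam M \<Longrightarrow> c0 x < q"
    and c0_card: "\<And>j u v. j < q \<Longrightarrow> u \<in> M \<Longrightarrow> v \<in> M \<Longrightarrow> u \<noteq> v \<Longrightarrow>
      card {i. i < lam \<and> c0 ({u, v}, i) = j} = w j u v"
  obtains c where "\<And>x. x \<in> complete_multigraph lam M \<Longrightarrow> c x = c0 x"
    and "\<And>x. x \<in> complete_multigraph lam V \<Longrightarrow> c x < q"
    and "\<And>j u v. j < q \<Longrightarrow> u \<in> V \<Longrightarrow> v \<in> V \<Longrightarrow> u \<noteq> v \<Longrightarrow>
      card {i. i < lam \<and> c ({u, v}, i) = j} = w j u v"
proof -
  let ?pairs = "{e. e \<subseteq> V \<and> card e = 2}"
  have "\<exists>c. (\<forall>i<lam. c i < q) \<and> (e \<subseteq> M \<longrightarrow> c = (\<lambda>i. c0 (e, i))) \<and>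
      (\<forall>j<q. \<forall>u v. e = {u, v} \<longrightarrow> card {i. i < lam \<and> c i = j} = w j u v)"
    if e: "e \<in> ?pairs" for e
  proof -
    obtain a b where ab: "e = {a, b}" "a \<noteq> b" using e by (auto simp: card_2_iff)
    have inV: "a \<in> V" "b \<in> V" using ab e by auto
    \<comment> \<open>A pair can be written in two orders; symmetry makes the prescribed
      multiplicity independent of the choice.\<close>
    have pair: "w j u v = w j a b" if "j < q" "e = {u, v}" for j u v
      using that ab inV sym by (auto simp: doubleton_eq_iff)
    obtain c where c: "\<forall>i<lam. c i < q" "e \<subseteq> M \<Longrightarrow> c = (\<lambda>i. c0 (e, i))"
      and card: "\<forall>j<q. card {i. i < lam \<and> c i = j} = w j a b"
    proof (cases "e \<subseteq> M")
      case True
      then have abM: "a \<in> M" "b \<in> M" using ab by auto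
      show thesis
      proof (rule that[of "\<lambda>i. c0 (e, i)"])
        show "\<forall>i<lam. c0 (e, i) < q"
          using c0_less abM ab by (simp add: pair_in_complete_multigraph)
        show "\<forall>j<q. card {i. i < lam \<and> c0 (e, i) = j} = w j a b"
          unfolding ab(1) using c0_card abM ab(2) by blast
      qed simp
    next
      case False
      obtain c where "\<forall>i<lam. c i < q" "\<forall>j<q. card {i. i < lam \<and> c i = j} = w j a b"
        using exists_colouring_with_fibre_sizes[OF w_sum[OF inV ab(2)]] by blast
      then show thesis using False by (intro that[of c]) auto
    qed
    show ?thesis
    proof (intro exI[of _ c] conjI impI allI)
      fix j u v assume "j < q" "e = {u, v}"
      then show "card {i. i < lam \<and> c i = j} = w j u v" using card pair by simp
    qed (use c in simp_all)
  qed
  then have "\<exists>c. \<forall>e\<in>?pairs. (\<forall>i<lam. c e i < q) \<and> (e \<subseteq> M \<longrightarrow> c e = (\<lambda>i. c0 (e, i))) \<and>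
      (\<forall>j<q. \<forall>u v. e = {u, v} \<longrightarrow> card {i. i < lam \<and> c e i = j} = w j u v)"
    by (intro bchoice ballI)
  then obtain c where c: "\<forall>e\<in>?pairs. (\<forall>i<lam. c e i < q) \<and> (e \<subseteq> M \<longrightarrow> c e = (\<lambda>i. c0 (e, i))) \<and>
      (\<forall>j<q. \<forall>u v. e = {u, v} \<longrightarrow> card {i. i < lam \<and> c e i = j} = w j u v)" ..
  define c' where "c' = (\<lambda>x. if x \<in> complete_multigraph lam M then c0 x else c (fst x) (snd x))"
  show thesis
  proof
    fix x assume "x \<in> complete_multigraph lam M"
    then show "c' x = c0 x" by (simp add: c'_def)
  next
    fix x assume "x \<in> complete_multigraph lam V"
    then show "c' x < q"
      using c c0_less by (auto simp: c'_def complete_multigraph_def)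
  next
    fix j u v assume j: "j < q" and uv: "u \<in> V" "v \<in> V" "u \<noteq> v"
    then have e: "{u, v} \<in> ?pairs" by simp
    have "c {u, v} = (\<lambda>i. c0 ({u, v}, i))" if "u \<in> M" "v \<in> M" using bspec[OF c e] that by simp
    then have "c' ({u, v}, i) = c {u, v} i" if "i < lam" for i
      using that by (simp add: c'_def pair_in_complete_multigraph)
    then have "{i. i < lam \<and> c' ({u, v}, i) = j} = {i. i < lam \<and> c {u, v} i = j}" by auto
    then show "card {i. i < lam \<and> c' ({u, v}, i) = j} = w j u v"
      using bspec[OF c e] j by simp
  qed
qed

section \<open>Extension of factorizations\<close>

text \<open>As \<open>s > 0\<close> and \<open>V\<close> is nonempty, no colour class is empty; a
  partition needs this, and it also makes distinct colours give distinct factors.\<close>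

lemma connected_edge_classes:
  assumes V: "finite V" "V \<noteq> {}" and s: "s > 0"
    and w: "connected_colouring q s lam V w"
    and c_less: "\<And>x. x \<in> complete_multigraph lam V \<Longrightarrow> c x < q"
    and c_card: "\<And>j u v. j < q \<Longrightarrow> u \<in> V \<Longrightarrow> v \<in> V \<Longrightarrow> u \<noteq> v \<Longrightarrow>
      card {i. i < lam \<and> c ({u, v}, i) = j} = w j u v"
  defines "H \<equiv> \<lambda>j. {x \<in> complete_multigraph lam V. c x = j}"
  shows "factorization s V (complete_multigraph lam V) (H ` {..<q})"
    and "\<And>j. j < q \<Longrightarrow> connected_multigraph V (H j)"
    and "inj_on H {..<q}"
proof -
  note w = w[unfolded connected_colouring_def]
  have sub: "H j \<subseteq> complete_multigraph lam V" for j by (auto simp: H_def)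
  have mult: "edge_mult (H j) u v = w j u v" if "j < q" "u \<in> V" "v \<in> V" for j u v
  proof (cases "u = v")
    case True
    then show ?thesis using w that edge_mult_self[OF sub] by simp
  next
    case False
    then have "{i. ({u, v}, i) \<in> H j} = {i. i < lam \<and> c ({u, v}, i) = j}"
      using that by (auto simp: H_def pair_in_complete_multigraph)
    then show ?thesis using c_card[OF that False] by (simp add: edge_mult_def)
  qed
  have deg: "degree (H j) v = s" if "j < q" "v \<in> V" for j v
  proof -
    have "degree (H j) v = (\<Sum>u\<in>V. w j v u)"
      unfolding degree_eq_sum_edge_mult[OF sub V(1)] using that mult by (intro sum.cong) auto
    also have "\<dots> = s" using w that by blast
    finally show ?thesis .
  qed
  have ne: "H j \<noteq> {}" if j: "j < q" for j
  proof
    assume "H j = {}"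
    moreover obtain v where "v \<in> V" using V(2) by blast
    ultimately show False using deg[OF j, of v] s by (simp add: degree_def)
  qed
  show "factorization s V (complete_multigraph lam V) (H ` {..<q})"
    unfolding factorization_def
  proof
    show "partition_on (complete_multigraph lam V) (H ` {..<q})"
    proof (rule partition_onI)
      show "\<Union>(H ` {..<q}) = complete_multigraph lam V" using c_less by (auto simp: H_def)
      show "{} \<notin> H ` {..<q}" using ne by auto
    qed (auto simp: H_def disjnt_def)
    show "\<forall>F\<in>H ` {..<q}. is_factor s V (complete_multigraph lam V) F"
      using deg sub by (auto simp: is_factor_def)
  qed
  show "inj_on H {..<q}"
  proof (rule inj_onI)
    fix j j' assume "j \<in> {..<q}" "j' \<in> {..<q}" and eq: "H j = H j'"
    then obtain x where "x \<in> H j" "x \<in> H j'" using ne[of j] by auto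
    then show "j = j'" by (auto simp: H_def)
  qed
  fix j assume j: "j < q"
  show "connected_multigraph V (H j)"
    unfolding connected_multigraph_def
  proof (intro conjI ballI)
    fix u v assume u: "u \<in> V" and v: "v \<in> V"
    \<comment> \<open>The set of vertices reachable from \<open>u\<close> sends no edge of colour
      \<open>j\<close> outwards, so the cut condition makes it all of \<open>V\<close>.\<close>
    let ?C = "{x\<in>V. (u, x) \<in> (adj_rel (H j))\<^sup>*}"
    have "w j x y = 0" if x: "x \<in> ?C" and y: "y \<in> V - ?C" for x y
    proof (rule ccontr)
      assume "w j x y \<noteq> 0"
      then have "edge_mult (H j) x y > 0" using mult[OF j] x y by simp
      then have "(x, y) \<in> adj_rel (H j)"
        by (auto simp: edge_mult_pos_iff[OF sub] adj_rel_def intro: bexI[rotated])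
      then have "(u, y) \<in> (adj_rel (H j))\<^sup>*" using x by (auto intro: rtrancl_into_rtrancl)
      with y show False by simp
    qed
    then have closed: "\<forall>x\<in>?C. \<forall>y\<in>V - ?C. w j x y = 0" by blast
    have "\<forall>C\<subseteq>V. C \<noteq> {} \<longrightarrow> (\<forall>u\<in>C. \<forall>v\<in>V - C. w j u v = 0) \<longrightarrow> C = V"
      using w j by blast
    then have "?C = V"
    proof (elim allE[of _ ?C] impE)
      show "?C \<noteq> {}" using u by blast
    qed (use closed in auto)
    then show "(u, v) \<in> (adj_rel (H j))\<^sup>*" using v by blast
  qed (rule V(2))
qed

text \<open>This makes room at \<alpha>: the \<open>m * (s - r)\<close> edges leaving
  \<open>M\<close> in the colour of a given factor must fit among its \<open>s * (n - m)\<close>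
  edge ends. If \<open>n < 2 * m\<close>, the ratio bound holds with equality, so
  \<open>s * (n - m) = (n - 1) * (s - r)\<close>, and \<open>m \<le> n - 1\<close>.\<close>

lemma new_degree_bound:
  fixes m n r s :: nat
  assumes m: "0 < m" "m < n" and le: "s * (m - 1) \<le> r * (n - 1)"
    and room: "s * (m - 1) < r * (n - 1) \<Longrightarrow> 2 * m \<le> n"
  shows "m * (s - r) \<le> s * (n - m)"
proof (cases "2 * m \<le> n")
  case True
  then have "m * (s - r) \<le> (n - m) * s" by (intro mult_le_mono) auto
  then show ?thesis by (simp add: mult.commute)
next
  case False
  then have eq: "s * (m - 1) = r * (n - 1)" using le room by linarith
  have "(n - 1) * (s - r) = (n - 1) * s - (n - 1) * r" by (rule diff_mult_distrib2)
  also have "\<dots> = s * (n - 1) - s * (m - 1)" unfolding eq by (simp only: mult.commute)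
  also have "\<dots> = s * (n - m)" using m by (simp flip: diff_mult_distrib2)
  finally have "(n - 1) * (s - r) = s * (n - m)" .
  moreover have "m * (s - r) \<le> (n - 1) * (s - r)" using m by (intro mult_le_mono1) linarith
  ultimately show ?thesis by simp
qed

lemma extension_sufficient:
  assumes r: "r > 0" and lam: "lam > 0"
    and V: "finite V" and MV: "M \<subset> V" and M1: "card M > 1"
    and P: "factorization r M (complete_multigraph lam M) P"
    and adm: "two_admissible (card M) r lam" "two_admissible (card V) s lam"
    and rs: "r < s" and le: "s * (card M - 1) \<le> r * (card V - 1)"
    and room: "s * (card M - 1) < r * (card V - 1) \<Longrightarrow> 2 * card M \<le> card V"
  shows "extends_to_connected_factorization s V (complete_multigraph lam V) P"
proof -
  define m where "m = card M"
  define n where "n = card V"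
  define h where "h = n - m"
  define k where "k = card P"
  \<comment> \<open>The number of \<open>s\<close>-factors forced by the degree; admissibility makes
    the division exact.\<close>
  define q where "q = lam * (n - 1) div s"
  have fM: "finite M" using V MV by (auto intro: finite_subset)
  have Mne: "M \<noteq> {}" using M1 by auto
  have mn: "1 < m" "m < n" using psubset_card_mono[OF V MV] M1 by (auto simp: m_def n_def)
  note le = le[folded m_def n_def] and room = room[folded m_def n_def]
  have s0: "s > 0" using rs by simp
  have kr: "k * r = lam * (m - 1)"
    using factorization_complete_card[OF P fM Mne] by (simp add: k_def m_def)
  have qs: "q * s = lam * (n - 1)"
    using adm(2) by (simp add: two_admissible_def q_def n_def)
  have k_scaled: "lam * (s * (m - 1)) = k * (r * s)"
    unfolding mult.left_commute[of lam] kr[symmetric] by (simp add: ac_simps)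
  have q_scaled: "lam * (r * (n - 1)) = q * (r * s)"
    unfolding mult.left_commute[of lam] qs[symmetric] by (simp add: ac_simps)
  have "k * (r * s) \<le> q * (r * s)"
    unfolding k_scaled[symmetric] q_scaled[symmetric] using le by (rule mult_le_mono2)
  then have kq: "k \<le> q" using r s0 by simp
  have extra: "2 * m \<le> n" if "k < q"
  proof (rule room)
    have "lam * (s * (m - 1)) < lam * (r * (n - 1))"
      unfolding k_scaled q_scaled using that r s0 by simp
    then show "s * (m - 1) < r * (n - 1)" by simp
  qed
  have finP: "finite P" using factorization_finite[OF P] finite_complete_multigraph[OF fM] by blast
  then obtain F where F: "bij_betw F {..<k} P"
    using ex_bij_betw_nat_finite[OF finP] by (auto simp: k_def atLeast0LessThan)
  have PF: "P = F ` {..<k}" using F by (simp add: bij_betw_def)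
  have part: "partition_on (complete_multigraph lam M) P" using P by (simp add: factorization_def)
  have F_factor: "is_factor r M (complete_multigraph lam M) (F j)" if "j < k" for j
    using that P PF by (auto simp: factorization_def)
  then have F_sub: "F j \<subseteq> complete_multigraph lam M" if "j < k" for j
    using that by (simp add: is_factor_def)
  have F_cover: "\<exists>j<k. x \<in> F j" if "x \<in> complete_multigraph lam M" for x
    using that partition_onD1[OF part] PF by auto
  have F_unique: "j = j'" if "j < k" "j' < k" "x \<in> F j" "x \<in> F j'" for j j' x
  proof -
    have "F j = F j'"
      using that partition_onD2[OF part] PF by (auto simp: disjoint_def)
    then show ?thesis using F that by (auto simp: bij_betw_def inj_on_def)
  qed
  define c0 where "c0 = (\<lambda>x. SOME j. j < k \<and> x \<in> F j)"
  have c0: "c0 x < k" "x \<in> F (c0 x)" if "x \<in> complete_multigraph lam M" for x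
    using someI_ex[OF F_cover[OF that]] by (auto simp: c0_def)
  define w where "w = (\<lambda>j u v. if j < k then edge_mult (F j) u v else 0)"
  define \<delta> where "\<delta> = (\<lambda>j. if j < k then s - r else s)"
  define l where "l = (\<lambda>j. (s * h - m * \<delta> j) div 2)"
  have c0_card: "card {i. i < lam \<and> c0 ({u, v}, i) = j} = w j u v"
    if "j < q" and uv: "u \<in> M" "v \<in> M" "u \<noteq> v" for j u v
  proof -
    have inK: "({u, v}, i) \<in> complete_multigraph lam M" if "i < lam" for i
      using that uv by (simp add: pair_in_complete_multigraph)
    show ?thesis
    proof (cases "j < k")
      case True
      have "i < lam \<and> c0 ({u, v}, i) = j \<longleftrightarrow> ({u, v}, i) \<in> F j" for i
      proof
        assume "i < lam \<and> c0 ({u, v}, i) = j"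
        then show "({u, v}, i) \<in> F j" using c0(2)[OF inK] by blast
      next
        assume *: "({u, v}, i) \<in> F j"
        then have "({u, v}, i) \<in> complete_multigraph lam M" using F_sub[OF True] by blast
        then show "i < lam \<and> c0 ({u, v}, i) = j"
          using F_unique[OF _ True _ *] c0 by (auto simp: pair_in_complete_multigraph)
      qed
      then show ?thesis using True by (simp add: w_def edge_mult_def)
    next
      case False
      have "c0 ({u, v}, i) \<noteq> j" if "i < lam" for i using c0(1)[OF inK[OF that]] False by simp
      then have "{i. i < lam \<and> c0 ({u, v}, i) = j} = {}" by blast
      then show ?thesis using False by (simp only: w_def card.empty if_False)
    qed
  qed
  have M_deg: "(\<Sum>v\<in>M. w j u v) + \<delta> j = s" if "j < q" "u \<in> M" for j u
  proof (cases "j < k")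
    case True
    then have "(\<Sum>v\<in>M. w j u v) = degree (F j) u"
      using degree_eq_sum_edge_mult[OF F_sub fM] by (simp add: w_def)
    also have "\<dots> = r" using F_factor[OF True] that by (simp add: is_factor_def)
    finally show ?thesis using True rs by (simp add: \<delta>_def)
  qed (simp add: w_def \<delta>_def)
  have even: "even (r * m)" "even (s * n)"
    using adm by (simp_all add: two_admissible_def m_def n_def)
  \<comment> \<open>Without this the subtraction in \<open>l\<close> could truncate. For a spare
    colour it amounts to \<open>m \<le> h\<close>.\<close>
  have \<delta>_le: "m * \<delta> j \<le> s * h" if "j < q" for j
  proof (cases "j < k")
    case True
    then show ?thesis using new_degree_bound[OF _ mn(2) le room] mn by (simp add: \<delta>_def h_def)
  next
    case False
    then have "2 * m \<le> n" using extra that by linarith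
    then have "m * s \<le> h * s" unfolding h_def by (intro mult_le_mono1) linarith
    then show ?thesis using False by (simp add: \<delta>_def mult.commute)
  qed
  \<comment> \<open>The division by 2 in \<open>l\<close> is exact: as \<open>s * n\<close> and
    \<open>r * m\<close> are even, \<open>s * h\<close>, \<open>m * s\<close> and
    \<open>m * (s - r)\<close> have the same parity.\<close>
  have l: "m * \<delta> j + 2 * l j = s * h" if "j < q" for j
  proof -
    have "s * n = s * h + s * m" using mn by (simp add: h_def flip: add_mult_distrib2)
    then have "even (s * h) \<longleftrightarrow> even (m * s)"
      using even(2) by (metis even_add mult.commute)
    moreover have "m * s = m * (s - r) + r * m"
      using rs by (simp add: mult.commute[of r] flip: add_mult_distrib2)
    then have "even (m * s) \<longleftrightarrow> even (m * (s - r))" using even(1) by (metis even_add)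
    ultimately have "even (s * h) \<longleftrightarrow> even (m * \<delta> j)"
      unfolding \<delta>_def by (cases "j < k") simp_all
    then have "even (s * h - m * \<delta> j)" by simp
    then show ?thesis using \<delta>_le[OF that] by (simp add: l_def)
  qed
  \<comment> \<open>The sum is \<open>q * s - k * r\<close>, that is,
    \<open>lam * (n - 1) - lam * (m - 1)\<close>.\<close>
  have \<delta>_sum: "(\<Sum>j<q. \<delta> j) = lam * h"
  proof -
    have "(\<Sum>j<q. \<delta> j) + (\<Sum>j<q. if j < k then r else 0) = (\<Sum>j<q. s)"
      unfolding sum.distrib[symmetric] using rs by (intro sum.cong) (auto simp: \<delta>_def)
    moreover have "(\<Sum>j<q. if j < k then r else 0) = (\<Sum>j<k. r)"
      using kq by (intro sum.mono_neutral_cong_right) auto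
    ultimately have "(\<Sum>j<q. \<delta> j) + lam * (m - 1) = lam * (n - 1)" using kr qs by simp
    moreover have "lam * (n - 1) = lam * h + lam * (m - 1)"
      using mn by (simp add: h_def flip: add_mult_distrib2)
    ultimately show ?thesis by simp
  qed
  have am: "amalgam q s lam h M w (\<lambda>j u. \<delta> j) l"
  proof
    show "finite M" by (rule fM)
    show "2 \<le> s" using r rs by simp
    show "1 \<le> h" using mn by (simp add: h_def)
  next
    fix j u show "w j u u = 0" using edge_mult_self[OF F_sub] by (simp add: w_def)
  next
    fix j u v show "w j u v = w j v u" by (simp add: w_def edge_mult_commute)
  next
    fix u v assume uv: "u \<in> M" "v \<in> M" "u \<noteq> v"
    have "(\<Sum>j<q. w j u v) = (\<Sum>j<q. card {i \<in> {..<lam}. c0 ({u, v}, i) = j})"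
      using c0_card uv by (intro sum.cong) auto
    also have "\<dots> = card {..<lam}"
    proof -
      have "(\<lambda>i. c0 ({u, v}, i)) ` {..<lam} \<subseteq> {..<q}"
      proof (rule image_subsetI)
        fix i assume "i \<in> {..<lam}"
        then have "c0 ({u, v}, i) < k"
          using uv by (intro c0(1)) (simp add: pair_in_complete_multigraph)
        then show "c0 ({u, v}, i) \<in> {..<q}" using kq by simp
      qed
      then show ?thesis using sum.group[of "{..<lam}" "{..<q}" "\<lambda>i. c0 ({u, v}, i)" "\<lambda>_. 1::nat"] by simp
    qed
    finally show "(\<Sum>j<q. w j u v) = lam" by simp
  next
    fix u show "(\<Sum>j<q. \<delta> j) = lam * h" by (rule \<delta>_sum)
  next
    have "(\<Sum>j<q. m * \<delta> j + 2 * l j) = (\<Sum>j<q. s * h)" using l by simp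
    then have "m * (lam * h) + 2 * (\<Sum>j<q. l j) = q * s * h"
      by (simp add: sum.distrib flip: sum_distrib_left \<delta>_sum)
    moreover have "q * s * h = m * (lam * h) + lam * h * (h - 1)"
    proof -
      have "n - 1 = m + (h - 1)" using mn by (simp add: h_def)
      then show ?thesis unfolding qs by (simp add: algebra_simps)
    qed
    ultimately show "2 * (\<Sum>j<q. l j) = lam * h * (h - 1)" by simp
  next
    fix j u assume "j < q" "u \<in> M"
    then show "(\<Sum>v\<in>M. w j u v) + \<delta> j = s" by (rule M_deg)
  next
    fix j assume "j < q"
    then show "(\<Sum>u\<in>M. \<delta> j) + 2 * l j = s * h" using l by (simp add: m_def)
  next
    fix j C assume j: "j < q" and C: "C \<subseteq> M" "C \<noteq> {}"
      and cl: "\<And>u v. u \<in> C \<Longrightarrow> v \<in> M - C \<Longrightarrow> w j u v = 0"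
    have finC: "finite C" using C fM by (auto intro: finite_subset)
    \<comment> \<open>In a spare colour even one vertex sends \<open>s \<ge> 2\<close> edges to
      \<alpha>. In the colour of a given factor a closed set has at least two vertices, since
      \<open>r > 0\<close> and there are no loops inside \<open>M\<close>, and each of them sends
      \<open>s - r \<ge> 1\<close>.\<close>
    have "2 \<le> card C * \<delta> j"
    proof (cases "j < k")
      case False
      have "1 * 2 \<le> card C * \<delta> j"
        using False r rs C finC by (intro mult_le_mono) (auto simp: \<delta>_def card_gt_0_iff Suc_le_eq)
      then show ?thesis by simp
    next
      case True
      obtain u where u: "u \<in> C" using C by blast
      have "(\<Sum>v\<in>M. w j u v) = r" using M_deg[OF j, of u] u C True rs by (auto simp: \<delta>_def)
      then obtain v where v: "v \<in> M" "w j u v \<noteq> 0" using r by (metis less_irrefl sum.neutral)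
      then have "v \<in> C" using cl[OF u, of v] by auto
      moreover have "u \<noteq> v" using v True edge_mult_self[OF F_sub[OF True]] by (auto simp: w_def)
      ultimately have "card {u, v} \<le> card C" using u finC by (intro card_mono) auto
      then have "2 * 1 \<le> card C * \<delta> j"
        using True rs \<open>u \<noteq> v\<close> by (intro mult_le_mono) (auto simp: \<delta>_def)
      then show ?thesis by simp
    qed
    then show "min 2 h \<le> (\<Sum>u\<in>C. \<delta> j)" by simp
  qed
  have hV: "card (V - M) = h" using MV fM by (simp add: h_def m_def n_def card_Diff_subset psubset_imp_subset)
  obtain w' where w': "connected_colouring q s lam V w'"
    and agree: "\<forall>j. \<forall>x\<in>M. \<forall>y\<in>M. w' j x y = w j x y"
    using amalgam_detachment[OF am V _ hV] MV by blast
  obtain c where c_old: "\<And>x. x \<in> complete_multigraph lam M \<Longrightarrow> c x = c0 x"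
    and c_less: "\<And>x. x \<in> complete_multigraph lam V \<Longrightarrow> c x < q"
    and c_card: "\<And>j u v. j < q \<Longrightarrow> u \<in> V \<Longrightarrow> v \<in> V \<Longrightarrow> u \<noteq> v \<Longrightarrow>
      card {i. i < lam \<and> c ({u, v}, i) = j} = w' j u v"
  proof (rule exists_edge_colouring[of q V w' lam M c0])
    show "w' j u v = w' j v u" if "j < q" "u \<in> V" "v \<in> V" for j u v
      using that w' by (simp add: connected_colouring_def)
    show "(\<Sum>j<q. w' j u v) = lam" if "u \<in> V" "v \<in> V" "u \<noteq> v" for u v
      using that w' by (simp add: connected_colouring_def)
    show "c0 x < q" if "x \<in> complete_multigraph lam M" for x using c0(1)[OF that] kq by simp
    show "card {i. i < lam \<and> c0 ({u, v}, i) = j} = w' j u v"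
      if "j < q" "u \<in> M" "v \<in> M" "u \<noteq> v" for j u v
      using c0_card[OF that] agree that by simp
  qed blast
  define H where "H = (\<lambda>j. {x \<in> complete_multigraph lam V. c x = j})"
  have Vne: "V \<noteq> {}" using MV by blast
  note H = connected_edge_classes[OF V Vne s0 w' c_less c_card, folded H_def]
  \<comment> \<open>The index of a given factor is recovered through the inverse of
    \<open>F\<close>, so that \<open>F j\<close> is sent to \<open>H j\<close>.\<close>
  define f where "f = (\<lambda>G. H (the_inv_into {..<k} F G))"
  have f: "f (F j) = H j" if "j < k" for j
    using that F by (simp add: f_def bij_betw_def the_inv_into_f_f)
  have F_H: "F j \<subseteq> H j" if j: "j < k" for j
  proof
    fix x assume x: "x \<in> F j"
    then have xM: "x \<in> complete_multigraph lam M" using F_sub[OF j] by blast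
    then have "c x = j" using c_old c0 F_unique[OF _ j _ x] by simp
    moreover have "x \<in> complete_multigraph lam V" using xM MV by (auto simp: complete_multigraph_def)
    ultimately show "x \<in> H j" by (simp add: H_def)
  qed
  have "f \<in> P \<rightarrow> H ` {..<q}" using f kq by (auto simp: PF)
  moreover have "inj_on f P"
  proof (rule inj_onI)
    fix A B assume "A \<in> P" "B \<in> P" "f A = f B"
    then obtain i j where "i < k" "j < k" "A = F i" "B = F j" "H i = H j" using f by (auto simp: PF)
    moreover from this have "i = j" using inj_onD[OF H(3)] kq by simp
    ultimately show "A = B" by simp
  qed
  moreover have "\<forall>A\<in>P. A \<subseteq> f A" using f F_H by (auto simp: PF)
  moreover have "\<forall>A\<in>H ` {..<q}. connected_multigraph V A"
    using H(2) by (auto simp: H_def)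
  ultimately show ?thesis
    unfolding extends_to_connected_factorization_def using H(1)
    by (intro exI[of _ "H ` {..<q}"] conjI bexI[of _ f])
qed

theorem theorem8p4:
  fixes m n r s lam :: nat and V M :: "'a set" and P :: "'a medge set set"
  assumes "r > 0" and "s > 0" and "lam > 0"
    and "m > 2" and "n > m"
    and "finite V" and "card V = n"
    and "M \<subseteq> V" and "card M = m"
    and "factorization r M (complete_multigraph lam M) P"
  shows "extends_to_connected_factorization s V (complete_multigraph lam V) P \<longleftrightarrow>
    (two_admissible m r lam \<and> two_admissible n s lam) \<and>
    (1 < real s / real r \<and> real s / real r \<le> (real n - 1) / (real m - 1)) \<and>
    (real s / real r < (real n - 1) / (real m - 1) \<longrightarrow> n \<ge> 2 * m)"
proof -
  have MV: "M \<subset> V" "card M > 1" using assms by auto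
  have pos: "real r > 0" "real m - 1 > 0" using assms by auto
  have m1: "real m - 1 = real (m - 1)" "real n - 1 = real (n - 1)" using assms by auto
  have lt1: "1 < real s / real r \<longleftrightarrow> r < s" using pos by simp
  have le: "real s / real r \<le> (real n - 1) / (real m - 1) \<longleftrightarrow> s * (m - 1) \<le> r * (n - 1)"
  proof -
    have "real s / real r \<le> (real n - 1) / (real m - 1) \<longleftrightarrow> real (s * (m - 1)) \<le> real (r * (n - 1))"
      using pos unfolding m1 of_nat_mult
      by (simp only: pos_divide_le_eq times_divide_eq_left pos_le_divide_eq mult.commute[of "real r"])
    then show ?thesis by (simp only: of_nat_le_iff)
  qed
  have lt: "real s / real r < (real n - 1) / (real m - 1) \<longleftrightarrow> s * (m - 1) < r * (n - 1)"
  proof -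
    have "real s / real r < (real n - 1) / (real m - 1) \<longleftrightarrow> real (s * (m - 1)) < real (r * (n - 1))"
      using pos unfolding m1 of_nat_mult
      by (simp only: pos_divide_less_eq times_divide_eq_left pos_less_divide_eq mult.commute[of "real r"])
    then show ?thesis by (simp only: of_nat_less_iff)
  qed
  note card = \<open>card V = n\<close> \<open>card M = m\<close>
  note nec = extension_necessary[OF assms(1-3) \<open>finite V\<close> MV assms(10), unfolded card]
  note suf = extension_sufficient[OF assms(1,3) \<open>finite V\<close> MV assms(10), unfolded card]
  show ?thesis
    unfolding lt1 le lt
  proof (intro iffI)
    assume "extends_to_connected_factorization s V (complete_multigraph lam V) P"
    from nec[OF this] show "(two_admissible m r lam \<and> two_admissible n s lam) \<and>
        (r < s \<and> s * (m - 1) \<le> r * (n - 1)) \<and> (s * (m - 1) < r * (n - 1) \<longrightarrow> 2 * m \<le> n)"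
      by simp
  qed (intro suf; simp)
qed

end
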